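(* Inconsistency of disjunctive finitely recursive programs is semidecidable: there is a procedure which, given a disjunctive finitely recursive program $P$, halts reporting inconsistency if and only if $P$ has no stable model.
   Context: A disjunctive program is a finite set of rules $A_1\vee\dots\vee A_m\leftarrow L_1,\dots,L_n$ ($m>0$, $n\ge0$), $A_j$ atoms, $L_i$ atoms or negated atoms $\mathtt{not}\,A$, over a first-order language possibly with function symbols (so the Herbrand universe may be infinite); $head(r)=\{A_1,\dots,A_m\}$. $\mathsf{Ground}(P)$ is its ground instantiation. For a set $M$ of ground atoms, $P^M$ is obtained from $\mathsf{Ground}(P)$ by deleting rules having some $\mathtt{not}\,B$ in the body with $B\in M$ and deleting negative literals from the remaining rules; $M$ is a stable model iff it is a minimal Herbrand model of $P^M$. $P$ is inconsistent iff it has no stable model. The dependency graph has ground atoms as vertices and an edge $A\to B$ whenever some $r\in\mathsf{Ground}(P)$ has $A\in head(r)$ and $B$ occurring in $r$ (body, positively or negated, or head); $A$ depends on $B$ if there is a directed path from $A$ to $B$ (every atom depends on itself). $P$ is finitely recursive iff each ground atom depends on finitely many ground atoms. *)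

theory Defs
  imports Main "HOL-Library.Nat_Bijection"
begin

text \<open>Variables, function symbols and predicate symbols are named by natural numbers.
  A function symbol is identified by its name together with its arity.\<close>

datatype trm = Var nat | Fn nat "trm list"

datatype atom = Atom nat "trm list"

datatype lit = Pos atom | Neg atom

text \<open>A rule A1 v ... v Am <- L1,...,Ln.\<close>
datatype rule = Rule (head: "atom list") (body: "lit list")

text \<open>A program is a finite set of rules, given as a list.\<close>
type_synonym program = "rule list"

definition wf_program :: "program \<Rightarrow> bool" where
  "wf_program P \<longleftrightarrow> (\<forall>r\<in>set P. head r \<noteq> [])"

fun lit_atom :: "lit \<Rightarrow> atom" where
  "lit_atom (Pos a) = a" | "lit_atom (Neg a) = a"

definition pos_body :: "rule \<Rightarrow> atom set" where
  "pos_body r = {a. Pos a \<in> set (body r)}"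

definition neg_body :: "rule \<Rightarrow> atom set" where
  "neg_body r = {a. Neg a \<in> set (body r)}"

definition rule_atoms :: "rule \<Rightarrow> atom set" where
  "rule_atoms r = set (head r) \<union> lit_atom ` set (body r)"

fun fsyms_trm :: "trm \<Rightarrow> (nat \<times> nat) set" where
  "fsyms_trm (Var x) = {}"
| "fsyms_trm (Fn f ts) = insert (f, length ts) (\<Union>t\<in>set ts. fsyms_trm t)"

fun fsyms_atom :: "atom \<Rightarrow> (nat \<times> nat) set" where
  "fsyms_atom (Atom p ts) = (\<Union>t\<in>set ts. fsyms_trm t)"

definition fsyms_prog :: "program \<Rightarrow> (nat \<times> nat) set" where
  "fsyms_prog P = (\<Union>r\<in>set P. \<Union>a\<in>rule_atoms r. fsyms_atom a)"

text \<open>Function symbols of the language of P; if P has no constant, a constant is added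
  (standard convention, so that the Herbrand universe is nonempty).\<close>
definition lang_fsyms :: "program \<Rightarrow> (nat \<times> nat) set" where
  "lang_fsyms P = (if (\<exists>c. (c, 0) \<in> fsyms_prog P) then fsyms_prog P
                   else insert (0, 0) (fsyms_prog P))"

fun pred_of :: "atom \<Rightarrow> nat" where
  "pred_of (Atom p ts) = p"

definition preds_prog :: "program \<Rightarrow> nat set" where
  "preds_prog P = (\<Union>r\<in>set P. pred_of ` rule_atoms r)"

inductive_set herbrand_universe :: "program \<Rightarrow> trm set" for P where
  "(f, length ts) \<in> lang_fsyms P \<Longrightarrow> (\<forall>t\<in>set ts. t \<in> herbrand_universe P)
     \<Longrightarrow> Fn f ts \<in> herbrand_universe P"

definition herbrand_base :: "program \<Rightarrow> atom set" where
  "herbrand_base P = {Atom p ts | p ts. p \<in> preds_prog P \<and> (\<forall>t\<in>set ts. t \<in> herbrand_universe P)}"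

fun subst_trm :: "(nat \<Rightarrow> trm) \<Rightarrow> trm \<Rightarrow> trm" where
  "subst_trm \<sigma> (Var x) = \<sigma> x"
| "subst_trm \<sigma> (Fn f ts) = Fn f (map (subst_trm \<sigma>) ts)"

fun subst_atom :: "(nat \<Rightarrow> trm) \<Rightarrow> atom \<Rightarrow> atom" where
  "subst_atom \<sigma> (Atom p ts) = Atom p (map (subst_trm \<sigma>) ts)"

fun subst_lit :: "(nat \<Rightarrow> trm) \<Rightarrow> lit \<Rightarrow> lit" where
  "subst_lit \<sigma> (Pos a) = Pos (subst_atom \<sigma> a)"
| "subst_lit \<sigma> (Neg a) = Neg (subst_atom \<sigma> a)"

fun subst_rule :: "(nat \<Rightarrow> trm) \<Rightarrow> rule \<Rightarrow> rule" where
  "subst_rule \<sigma> (Rule h b) = Rule (map (subst_atom \<sigma>) h) (map (subst_lit \<sigma>) b)"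

definition Ground :: "program \<Rightarrow> rule set" where
  "Ground P = {subst_rule \<sigma> r | \<sigma> r. r \<in> set P \<and> (\<forall>x. \<sigma> x \<in> herbrand_universe P)}"

text \<open>Gelfond-Lifschitz reduct: positive rules, represented by the head and the positive body.\<close>
definition reduct :: "program \<Rightarrow> atom set \<Rightarrow> (atom set \<times> atom set) set" where
  "reduct P M = {(set (head r), pos_body r) | r. r \<in> Ground P \<and> neg_body r \<inter> M = {}}"

definition is_model :: "(atom set \<times> atom set) set \<Rightarrow> atom set \<Rightarrow> bool" where
  "is_model R N \<longleftrightarrow> (\<forall>(H, B)\<in>R. B \<subseteq> N \<longrightarrow> H \<inter> N \<noteq> {})"

definition minimal_herbrand_model :: "program \<Rightarrow> (atom set \<times> atom set) set \<Rightarrow> atom set \<Rightarrow> bool" where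
  "minimal_herbrand_model P R M \<longleftrightarrow> M \<subseteq> herbrand_base P \<and> is_model R M \<and>
     \<not> (\<exists>N. N \<subset> M \<and> is_model R N)"

definition stable_model :: "program \<Rightarrow> atom set \<Rightarrow> bool" where
  "stable_model P M \<longleftrightarrow> minimal_herbrand_model P (reduct P M) M"

definition inconsistent :: "program \<Rightarrow> bool" where
  "inconsistent P \<longleftrightarrow> \<not> (\<exists>M. stable_model P M)"

definition dep_edges :: "program \<Rightarrow> (atom \<times> atom) set" where
  "dep_edges P = {(A, B). \<exists>r\<in>Ground P. A \<in> set (head r) \<and> B \<in> rule_atoms r}"

definition depends :: "program \<Rightarrow> atom \<Rightarrow> atom \<Rightarrow> bool" where
  "depends P A B \<longleftrightarrow> (A, B) \<in> (dep_edges P)\<^sup>*"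

definition finitely_recursive :: "program \<Rightarrow> bool" where
  "finitely_recursive P \<longleftrightarrow> (\<forall>A\<in>herbrand_base P. finite {B. depends P A B})"

datatype recf = Zero | Succ | Proj nat | Comp recf "recf list" | Prec recf recf | Minim recf

inductive eval :: "recf \<Rightarrow> nat list \<Rightarrow> nat \<Rightarrow> bool" where
  "eval Zero xs 0"
| "eval Succ [x] (Suc x)"
| "i < length xs \<Longrightarrow> eval (Proj i) xs (xs ! i)"
| "list_all2 (\<lambda>g y. eval g xs y) gs ys \<Longrightarrow> eval f ys z \<Longrightarrow> eval (Comp f gs) xs z"
| "eval f xs z \<Longrightarrow> eval (Prec f g) (0 # xs) z"
| "eval (Prec f g) (n # xs) y \<Longrightarrow> eval g (n # y # xs) z \<Longrightarrow> eval (Prec f g) (Suc n # xs) z"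
| "eval f (y # xs) 0 \<Longrightarrow> (\<forall>i<y. \<exists>v. 0 < v \<and> eval f (i # xs) v) \<Longrightarrow> eval (Minim f) xs y"

definition halts :: "recf \<Rightarrow> nat \<Rightarrow> bool" where
  "halts f n \<longleftrightarrow> (\<exists>v. eval f [n] v)"

fun enc_trm :: "trm \<Rightarrow> nat" where
  "enc_trm (Var x) = prod_encode (0, x)"
| "enc_trm (Fn f ts) = prod_encode (1, prod_encode (f, list_encode (map enc_trm ts)))"

fun enc_atom :: "atom \<Rightarrow> nat" where
  "enc_atom (Atom p ts) = prod_encode (p, list_encode (map enc_trm ts))"

fun enc_lit :: "lit \<Rightarrow> nat" where
  "enc_lit (Pos a) = prod_encode (0, enc_atom a)"
| "enc_lit (Neg a) = prod_encode (1, enc_atom a)"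

fun enc_rule :: "rule \<Rightarrow> nat" where
  "enc_rule (Rule h b) = prod_encode (list_encode (map enc_atom h), list_encode (map enc_lit b))"

definition enc_prog :: "program \<Rightarrow> nat" where
  "enc_prog P = list_encode (map enc_rule P)"

end

theory Submission
  imports Defs
begin

text \<open>Dependencies run through heads as well as bodies, so a set \<open>U\<close> of ground atoms that is
  closed under dependency is a splitting set: if \<open>M\<close> is stable, then \<open>M \<inter> U\<close> is stable for
  the ground rules whose head meets \<open>U\<close>. In a finitely recursive program the finite closed sets
  cover the Herbrand base, and Koenig's lemma glues stable models of the finite parts to one of the
  whole program. Hence inconsistency is witnessed by a finite closed \<open>U\<close> whose part of the
  program has no stable model. Whether \<open>U\<close> is a witness is primitive recursive, because only
  ground substitutions by terms of bounded code have to be considered; a partial recursive function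
  searches for a witness.\<close>

section \<open>Recursive functions\<close>

text \<open>The closure of an atom under dependency is never computed. A candidate \<open>U\<close>
  is guessed as the number \<open>u\<close> coding it, and closedness and the absence of a stable
  model are tested afterwards. The obstacle is that even this test speaks about infinitely many
  ground substitutions. Finite recursiveness therefore enters twice: it provides the finite closed
  sets, and it ensures that every ground rule whose head meets \<open>U\<close> is an instance by
  terms with codes bounded in \<open>u\<close> and the program code. The test \<open>refutes\<close>
  is total on all pairs of numbers, but it is given a meaning only on codes of finitely recursive
  programs. Atoms are replaced by their codes before any combinatorics is done. The same notions,
  for sets of rules over natural numbers, then apply both to the true ground program
  \<open>ground_codes\<close> and to its bounded part \<open>code_rules\<close>; these two need to
  agree only on the rules meeting \<open>U\<close>.\<close>

inductive_cases eval_ZeroE: "eval Zero xs y"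
inductive_cases eval_SuccE: "eval Succ xs y"
inductive_cases eval_ProjE: "eval (Proj i) xs y"
inductive_cases eval_CompE: "eval (Comp f gs) xs y"
inductive_cases eval_Prec_0E: "eval (Prec f g) (0 # xs) y"
inductive_cases eval_Prec_SucE: "eval (Prec f g) (Suc n # xs) y"
inductive_cases eval_MinimE: "eval (Minim f) xs y"

text \<open>Needed to read a halting search backwards: the 0 at which \<open>Minim\<close> stops
  must be the known value of the total test function.\<close>

lemma eval_det: "eval f xs y \<Longrightarrow> eval f xs z \<Longrightarrow> y = z"
proof (induction arbitrary: z rule: eval.induct)
  case (1 xs)
  then show ?case by (rule eval_ZeroE) simp
next
  case (2 x)
  then show ?case by (rule eval_SuccE) simp
next
  case (3 i xs)
  from 3(2) show ?case by (rule eval_ProjE) simp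
next
  case (4 xs gs ys f w)
  from 4(4) obtain ys' where ys': "list_all2 (\<lambda>g y. eval g xs y) gs ys'" "eval f ys' z"
    by (rule eval_CompE)
  have "ys = ys'"
  proof (rule nth_equalityI)
    show "length ys = length ys'"
      using list_all2_lengthD[OF 4(1)] list_all2_lengthD[OF ys'(1)] by simp
  next
    fix i assume i: "i < length ys"
    have "i < length ys'" using i list_all2_lengthD[OF 4(1)] list_all2_lengthD[OF ys'(1)] by simp
    with list_all2_nthD2[OF ys'(1)] have "eval (gs ! i) xs (ys' ! i)" by simp
    then show "ys ! i = ys' ! i" using list_all2_nthD2[OF 4(1) i] by blast
  qed
  with ys'(2) have "eval f ys z" by simp
  then show ?case by (rule 4(2))
next
  case (5 f xs w g)
  from "5.prems" have "eval f xs z" by (rule eval_Prec_0E)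
  then show ?case by (rule "5.IH")
next
  case (6 f g n xs y w)
  from "6.prems" obtain y' where y': "eval (Prec f g) (n # xs) y'" "eval g (n # y' # xs) z"
    by (rule eval_Prec_SucE)
  from "6.IH"(1)[OF y'(1)] y'(2) have "eval g (n # y # xs) z" by simp
  then show ?case by (rule "6.IH"(2))
next
  case (7 f y xs)
  have z: "eval f (z # xs) 0 \<and> (\<forall>i<z. \<exists>v>0. eval f (i # xs) v)"
    by (rule eval_MinimE[OF "7.prems"]) blast
  \<comment> \<open>If two minimization results differed, the body would take both 0 and a positive
    value at the smaller one.\<close>
  show ?case
  proof (rule linorder_cases[of y z])
    assume "y < z"
    with z obtain v where v: "v > 0" "eval f (y # xs) v" by blast
    from "7.IH"(1)[OF v(2)] v(1) show ?thesis by simp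
  next
    assume "z < y"
    with "7.IH"(2) obtain v where v: "v > 0" "\<forall>x. eval f (z # xs) x \<longrightarrow> v = x" by blast
    from v(2) z have "v = 0" by blast
    with v(1) show ?thesis by simp
  qed
qed

lemma eval_Proj: "i < length xs \<Longrightarrow> v = xs ! i \<Longrightarrow> eval (Proj i) xs v"
  by (simp add: eval.intros(3))

lemma eval_Comp1: "eval g xs y \<Longrightarrow> eval f [y] z \<Longrightarrow> eval (Comp f [g]) xs z"
  by (rule eval.intros(4)[of _ _ "[y]"]) auto

lemma eval_Comp2: "eval g xs y \<Longrightarrow> eval h xs y' \<Longrightarrow> eval f [y, y'] z \<Longrightarrow> eval (Comp f [g, h]) xs z"
  by (rule eval.intros(4)[of _ _ "[y, y']"]) auto

section \<open>Arithmetic and Cantor pairing as recursive function terms\<close>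

definition r_add :: recf where "r_add = Prec (Proj 0) (Comp Succ [Proj 1])"
definition r_pred :: recf where "r_pred = Prec Zero (Proj 0)"
text \<open>\<open>Prec\<close> recurses on its first argument, so the subtrahend comes
  first.\<close>

definition r_sub :: recf where "r_sub = Prec (Proj 0) (Comp r_pred [Proj 1])"
definition r_tri :: recf where "r_tri = Prec Zero (Comp Succ [Comp r_add [Proj 0, Proj 1]])"
definition r_pair :: recf where "r_pair = Comp r_add [Comp r_tri [r_add], Proj 0]"

lemma eval_add: "eval r_add [m, n] (m + n)"
  unfolding r_add_def
proof (induction m)
  case 0 show ?case by (auto intro!: eval.intros(5) eval_Proj)
next
  case (Suc m)
  show ?case
    by (rule eval.intros(6)[OF Suc])
       (auto intro!: eval_Comp1 eval_Proj eval.intros(2))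
qed

lemma eval_pred: "eval r_pred [m] (m - 1)"
  unfolding r_pred_def
proof (induction m)
  case 0 show ?case by (auto intro!: eval.intros)
next
  case (Suc m)
  show ?case by (rule eval.intros(6)[OF Suc]) (auto intro!: eval_Proj)
qed

lemma eval_sub: "eval r_sub [m, n] (n - m)"
  unfolding r_sub_def
proof (induction m)
  case 0 show ?case by (auto intro!: eval.intros(5) eval_Proj)
next
  case (Suc m)
  have "eval (Comp r_pred [Proj 1]) [m, n - m, n] (n - m - 1)"
    by (rule eval_Comp1[OF _ eval_pred]) (simp add: eval_Proj)
  then show ?case
    using eval.intros(6)[OF Suc] by simp
qed

lemma eval_tri: "eval r_tri [m] (triangle m)"
  unfolding r_tri_def
proof (induction m)
  case 0 show ?case by (auto intro!: eval.intros)
next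
  case (Suc m)
  have "eval (Comp r_add [Proj 0, Proj 1]) [m, triangle m] (m + triangle m)"
    by (rule eval_Comp2[OF _ _ eval_add]) (simp_all add: eval_Proj)
  then have "eval (Comp Succ [Comp r_add [Proj 0, Proj 1]]) [m, triangle m] (Suc (m + triangle m))"
    by (rule eval_Comp1) (rule eval.intros(2))
  from eval.intros(6)[OF Suc this] show ?case by (simp add: add.commute)
qed

lemma eval_pair: "eval r_pair [m, n] (prod_encode (m, n))"
proof -
  have "eval (Comp r_tri [r_add]) [m, n] (triangle (m + n))"
    by (rule eval_Comp1[OF eval_add eval_tri])
  moreover have "eval (Proj 0) [m, n] m" by (simp add: eval_Proj)
  ultimately show ?thesis
    unfolding r_pair_def prod_encode_def split_conv by (rule eval_Comp2[OF _ _ eval_add])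
qed

abbreviation (input) pfst :: "nat \<Rightarrow> nat" where "pfst z \<equiv> fst (prod_decode z)"
abbreviation (input) psnd :: "nat \<Rightarrow> nat" where "psnd z \<equiv> snd (prod_decode z)"

lemma pfst_psnd_collapse: "prod_encode (pfst z, psnd z) = z"
  by simp

lemma prod_decode_0: "prod_decode 0 = (0, 0)"
  using prod_encode_inverse[of "(0, 0)"] by (simp add: prod_encode_def)

text \<open>The diagonal \<open>m + n\<close> of the decoded pair grows exactly when \<open>Suc z\<close> is the next triangular
  number. This makes the diagonal primitive recursive without decoding pairs.\<close>

lemma diagonal_step:
  "pfst (Suc z) + psnd (Suc z) =
     (pfst z + psnd z) + (1 - (triangle (Suc (pfst z + psnd z)) - Suc z))"
proof -
  obtain m n where z: "z = prod_encode (m, n)" using pfst_psnd_collapse[of z, symmetric] by blast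
  show ?thesis
  proof (cases n)
    case 0
    have "Suc z = prod_encode (0, Suc m)" unfolding z 0 prod_encode_def by simp
    moreover have "triangle (Suc m) - Suc z = 0" unfolding z 0 prod_encode_def by simp
    ultimately show ?thesis using z 0 by simp
  next
    case (Suc k)
    have "Suc z = prod_encode (Suc m, k)" unfolding z Suc prod_encode_def by simp
    moreover have "triangle (Suc (m + n)) - Suc z > 0" unfolding z Suc prod_encode_def by simp
    ultimately show ?thesis using z Suc by simp
  qed
qed

definition r_diag :: recf where
  "r_diag = Prec Zero (Comp r_add [Proj 1,
     Comp r_sub [Comp r_sub [Comp Succ [Proj 0], Comp r_tri [Comp Succ [Proj 1]]], Comp Succ
         [Zero]]])"

lemma eval_diag: "eval r_diag [z] (pfst z + psnd z)"
  unfolding r_diag_def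
proof (induction z)
  case 0
  show ?case unfolding prod_decode_0 by (simp add: eval.intros(1,5))
next
  case (Suc z)
  let ?d = "pfst z + psnd z"
  have "eval (Comp r_sub [Comp Succ [Proj 0], Comp r_tri [Comp Succ [Proj 1]]]) [z, ?d] (triangle
      (Suc ?d) - Suc z)"
  proof (rule eval_Comp2[OF _ _ eval_sub])
    show "eval (Comp Succ [Proj 0]) [z, ?d] (Suc z)"
      by (rule eval_Comp1[OF _ eval.intros(2)]) (simp add: eval_Proj)
    have "eval (Comp Succ [Proj 1]) [z, ?d] (Suc ?d)"
      by (rule eval_Comp1[OF _ eval.intros(2)]) (simp add: eval_Proj)
    then show "eval (Comp r_tri [Comp Succ [Proj 1]]) [z, ?d] (triangle (Suc ?d))"
      by (rule eval_Comp1[OF _ eval_tri])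
  qed
  moreover have "eval (Comp Succ [Zero]) [z, ?d] 1"
    using eval_Comp1[OF eval.intros(1) eval.intros(2)] by simp
  ultimately have "eval (Comp r_sub [Comp r_sub [Comp Succ [Proj 0], Comp r_tri [Comp Succ [Proj
      1]]], Comp Succ [Zero]])
      [z, ?d] (1 - (triangle (Suc ?d) - Suc z))"
    by (rule eval_Comp2[OF _ _ eval_sub])
  moreover have "eval (Proj 1) [z, ?d] ?d" by (simp add: eval_Proj)
  ultimately have "eval (Comp r_add [Proj 1,
     Comp r_sub [Comp r_sub [Comp Succ [Proj 0], Comp r_tri [Comp Succ [Proj 1]]], Comp Succ
         [Zero]]])
     [z, ?d] (?d + (1 - (triangle (Suc ?d) - Suc z)))"
    by (intro eval_Comp2[OF _ _ eval_add])
  then show ?case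
    unfolding diagonal_step by (rule eval.intros(6)[OF Suc])
qed

section \<open>Closure properties of total computable functions\<close>

text \<open>Totality is built in, and only unary functions are considered: further arguments are
  packed with \<open>prod_encode\<close>. Closure lemmas then act on the body of a single
  abstraction and can be chained by \<open>intro\<close>.\<close>

definition computable :: "(nat \<Rightarrow> nat) \<Rightarrow> bool" where
  "computable f \<longleftrightarrow> (\<exists>r. \<forall>x. eval r [x] (f x))"

lemma computable_id: "computable (\<lambda>x. x)"
  unfolding computable_def by (rule exI[of _ "Proj 0"]) (auto intro: eval_Proj)

lemma computable_comp:
  assumes "computable f" "computable g" shows "computable (\<lambda>x. f (g x))"
proof -
  from assms obtain r s where "\<And>x. eval r [x] (f x)" "\<And>x. eval s [x] (g x)"
    unfolding computable_def by blast
  then have "eval (Comp r [s]) [x] (f (g x))" for x by (intro eval_Comp1)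
  then show ?thesis unfolding computable_def by blast
qed

lemma computable_comp2:
  assumes h: "\<And>m n. eval r [m, n] (h m n)" and "computable f" "computable g"
  shows "computable (\<lambda>x. h (f x) (g x))"
proof -
  from assms(2,3) obtain s t where st: "\<And>x. eval s [x] (f x)" "\<And>x. eval t [x] (g x)"
    unfolding computable_def by blast
  have "eval (Comp r [s, t]) [x] (h (f x) (g x))" for x by (rule eval_Comp2[OF st h])
  then show ?thesis unfolding computable_def by blast
qed

lemma computable_Suc: "computable f \<Longrightarrow> computable (\<lambda>x. Suc (f x))"
  by (rule computable_comp[of Suc]) (auto simp: computable_def intro: eval.intros(2))

lemma computable_const: "computable (\<lambda>x. c)"
proof (induction c)
  case 0
  show ?case unfolding computable_def by (rule exI[of _ Zero]) (auto intro: eval.intros)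
qed (rule computable_Suc)

lemma computable_add: "computable f \<Longrightarrow> computable g \<Longrightarrow> computable (\<lambda>x. f x + g x)"
  by (rule computable_comp2[OF eval_add])

lemma computable_diff: "computable f \<Longrightarrow> computable g \<Longrightarrow> computable (\<lambda>x. f x - g x)"
  using computable_comp2[OF eval_sub, of g f] by simp

lemma computable_pair: "computable f \<Longrightarrow> computable g \<Longrightarrow> computable (\<lambda>x. prod_encode (f x, g x))"
  by (rule computable_comp2[OF eval_pair])

lemma computable_tri: "computable triangle"
  unfolding computable_def using eval_tri by blast

text \<open>A pair code is the triangular number of its diagonal plus the first component, so
  subtracting that triangular number recovers the component.\<close>

lemma computable_pfst: assumes "computable f" shows "computable (\<lambda>x. pfst (f x))"
proof -
  have d: "computable (\<lambda>z. pfst z + psnd z)" unfolding computable_def using eval_diag by blast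
  have "pfst z = z - triangle (pfst z + psnd z)" for z
  proof -
    have "z = triangle (pfst z + psnd z) + pfst z"
      using pfst_psnd_collapse[of z] unfolding prod_encode_def split_conv by (rule sym)
    then show ?thesis by linarith
  qed
  moreover have "computable (\<lambda>z. z - triangle (pfst z + psnd z))"
    by (intro computable_diff computable_id computable_comp[OF computable_tri] d)
  ultimately have "computable pfst" by presburger
  then show ?thesis using assms by (rule computable_comp)
qed

lemma computable_psnd: assumes "computable f" shows "computable (\<lambda>x. psnd (f x))"
proof -
  have "computable (\<lambda>z. pfst z + psnd z)" unfolding computable_def using eval_diag by blast
  then have "computable (\<lambda>z. pfst z + psnd z - pfst z)" by (intro computable_diff computable_pfst
      computable_id)
  then have "computable psnd" by simp
  then show ?thesis using assms by (rule computable_comp)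
qed

lemma computable_rec_nat:
  assumes "computable b" "computable f" "computable (\<lambda>z. h (pfst z) (pfst (psnd z)) (psnd (psnd
      z)))"
  shows "computable (\<lambda>x. rec_nat (f x) (h x) (b x))"
proof -
  from assms obtain rb rf rh where r: "\<And>x. eval rb [x] (b x)" "\<And>x. eval rf [x] (f x)"
    "\<And>z. eval rh [z] (h (pfst z) (pfst (psnd z)) (psnd (psnd z)))"
    unfolding computable_def by blast
  \<comment> \<open>The step function of \<open>Prec\<close> sees counter, previous value,
    parameter, while \<open>h\<close> takes the parameter first; the projections reorder
    them.\<close>
  let ?r = "Prec rf (Comp rh [Comp r_pair [Proj 2, Comp r_pair [Proj 0, Proj 1]]])"
  have g: "eval (Comp rh [Comp r_pair [Proj 2, Comp r_pair [Proj 0, Proj 1]]]) [n, y, x] (h x n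
      y)" for n y x
  proof (rule eval_Comp1)
    show "eval (Comp r_pair [Proj 2, Comp r_pair [Proj 0, Proj 1]]) [n, y, x] (prod_encode (x,
        prod_encode (n, y)))"
      by (auto intro!: eval_Comp2[OF _ _ eval_pair] eval_Proj)
    show "eval rh [prod_encode (x, prod_encode (n, y))] (h x n y)"
      using r(3)[of "prod_encode (x, prod_encode (n, y))"] by simp
  qed
  have "eval ?r [k, x] (rec_nat (f x) (h x) k)" for k x
  proof (induction k)
    case 0 show ?case using r(2) by (auto intro: eval.intros(5))
  next
    case (Suc k) show ?case using eval.intros(6)[OF Suc g] by simp
  qed
  then have "eval (Comp ?r [rb, Proj 0]) [x] (rec_nat (f x) (h x) (b x))" for x
    using r(1) by (auto intro!: eval_Comp2 eval_Proj)
  then show ?thesis unfolding computable_def by blast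
qed

section \<open>Decidable predicates, bounded quantifiers and unbounded search\<close>

definition decidable :: "(nat \<Rightarrow> bool) \<Rightarrow> bool" where
  "decidable p \<longleftrightarrow> computable (\<lambda>x. of_bool (p x))"

text \<open>The case distinction is a recursion on the truth value: zero steps give the else branch,
  one step gives the then branch.\<close>

lemma computable_if:
  assumes "decidable p" "computable f" "computable g"
  shows "computable (\<lambda>x. if p x then f x else g x)"
proof -
  have "computable (\<lambda>x. rec_nat (g x) (\<lambda>_ _. f x) (of_bool (p x)))"
    using assms unfolding decidable_def by (intro computable_rec_nat) (auto intro!:
        computable_comp[OF assms(2)] computable_pfst computable_id)
  moreover have "rec_nat (g x) (\<lambda>_ _. f x) (of_bool (p x)) = (if p x then f x else g x)" for x
    by simp
  ultimately show ?thesis by simp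
qed

lemma decidable_const: "decidable (\<lambda>x. b)"
  unfolding decidable_def by (rule computable_const)

lemma decidable_if:
  assumes "decidable p" "decidable q" "decidable r"
  shows "decidable (\<lambda>x. if p x then q x else r x)"
  using computable_if[OF assms(1) assms(2,3)[unfolded decidable_def]] unfolding decidable_def
  by (simp add: if_distrib)

lemma decidable_not: assumes "decidable p" shows "decidable (\<lambda>x. \<not> p x)"
proof -
  have "(if p x then False else True) = (\<not> p x)" for x by simp
  with decidable_if[OF assms decidable_const[of False] decidable_const[of True]] show ?thesis by
      simp
qed

lemma decidable_conj: assumes "decidable p" "decidable q" shows "decidable (\<lambda>x. p x \<and> q x)"
proof -
  have "(\<lambda>x. if p x then q x else False) = (\<lambda>x. p x \<and> q x)" by auto
  with decidable_if[OF assms decidable_const[of False]] show ?thesis by simp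
qed

lemma decidable_disj: assumes "decidable p" "decidable q" shows "decidable (\<lambda>x. p x \<or> q x)"
  using decidable_not[OF decidable_conj[OF assms[THEN decidable_not]]] by simp

lemma decidable_imp: assumes "decidable p" "decidable q" shows "decidable (\<lambda>x. p x \<longrightarrow> q x)"
  using decidable_disj[OF decidable_not[OF assms(1)] assms(2)] by (simp only: imp_conv_disj)

lemma decidable_le: assumes "computable f" "computable g" shows "decidable (\<lambda>x. f x \<le> g x)"
proof -
  have "of_bool (f x \<le> g x) = 1 - (f x - g x)" for x by auto
  then show ?thesis unfolding decidable_def using assms by (auto intro!: computable_diff
      computable_const)
qed

lemma decidable_eq: assumes "computable f" "computable g" shows "decidable (\<lambda>x. f x = g x)"
  using decidable_conj[OF decidable_le[OF assms] decidable_le[OF assms(2,1)]] by (simp add: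
      order_eq_iff)

lemma decidable_all_less:
  assumes "computable b" "decidable (\<lambda>z. p (pfst z) (psnd z))"
  shows "decidable (\<lambda>x. \<forall>i<b x. p x i)"
proof -
  have "rec_nat 1 (\<lambda>n y. if p x n then y else 0) k = (of_bool (\<forall>i<k. p x i) :: nat)" for k x
    by (induction k) (auto simp: less_Suc_eq)
  moreover have "decidable (\<lambda>z. p (pfst z) (pfst (psnd z)))"
  proof -
    have "computable (\<lambda>z. prod_encode (pfst z, pfst (psnd z)))"
      by (intro computable_pair computable_pfst computable_psnd computable_id)
    from computable_comp[OF assms(2)[unfolded decidable_def] this] show ?thesis by (simp add:
        decidable_def)
  qed
  then have "computable (\<lambda>x. rec_nat 1 (\<lambda>n y. if p x n then y else 0) (b x))"
    by (intro computable_rec_nat assms computable_const computable_if computable_psnd computable_id)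
  ultimately show ?thesis unfolding decidable_def by simp
qed

lemma decidable_ex_less:
  assumes "computable b" "decidable (\<lambda>z. p (pfst z) (psnd z))"
  shows "decidable (\<lambda>x. \<exists>i<b x. p x i)"
  using decidable_not[OF decidable_all_less[OF assms(1) decidable_not[OF assms(2)]]] by simp

lemma decidable_all_le:
  assumes "computable b" "decidable (\<lambda>z. p (pfst z) (psnd z))"
  shows "decidable (\<lambda>x. \<forall>i\<le>b x. p x i)"
  using decidable_all_less[OF computable_Suc[OF assms(1)] assms(2)] by (simp add: less_Suc_eq_le)

lemma decidable_ex_le:
  assumes "computable b" "decidable (\<lambda>z. p (pfst z) (psnd z))"
  shows "decidable (\<lambda>x. \<exists>i\<le>b x. p x i)"
  using decidable_ex_less[OF computable_Suc[OF assms(1)] assms(2)] by (simp add: less_Suc_eq_le)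

lemma halts_search:
  assumes "decidable (\<lambda>z. p (pfst z) (psnd z))"
  shows "\<exists>f. \<forall>x. halts f x \<longleftrightarrow> (\<exists>w. p x w)"
proof -
  \<comment> \<open>\<open>Minim\<close> looks for a zero, so the test is negated: 0 signals
    success.\<close>
  from decidable_not[OF assms] obtain r where r: "\<And>z. eval r [z] (of_bool (\<not> p (pfst z) (psnd z)))"
    unfolding decidable_def computable_def by blast
  \<comment> \<open>\<open>Minim\<close> puts the candidate in front of the input, hence the swapped
    projections.\<close>
  let ?g = "Comp r [Comp r_pair [Proj 1, Proj 0]]"
  have g: "eval ?g [w, x] (of_bool (\<not> p x w))" for w x
  proof (rule eval_Comp1)
    show "eval (Comp r_pair [Proj 1, Proj 0]) [w, x] (prod_encode (x, w))"
      by (auto intro!: eval_Comp2[OF _ _ eval_pair] eval_Proj)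
    show "eval r [prod_encode (x, w)] (of_bool (\<not> p x w))"
      using r[of "prod_encode (x, w)"] by simp
  qed
  have "halts (Minim ?g) x \<longleftrightarrow> (\<exists>w. p x w)" for x
  proof
    assume "halts (Minim ?g) x"
    then obtain w where "eval (Minim ?g) [x] w" unfolding halts_def by blast
    then have "eval ?g [w, x] 0" by (cases rule: eval.cases) auto
    from eval_det[OF this g] show "\<exists>w. p x w" by (auto split: if_splits)
  next
    assume "\<exists>w. p x w"
    define w where "w = (LEAST w. p x w)"
    from \<open>\<exists>w. p x w\<close> have w: "p x w" unfolding w_def by (meson LeastI_ex)
    have "eval (Minim ?g) [x] w"
    proof (rule eval.intros(7))
      show "eval ?g [w, x] 0" using g[of w x] w by simp
      show "\<forall>i<w. \<exists>v>0. eval ?g [i, x] v"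
      proof (intro allI impI)
        fix i assume "i < w"
        then have "\<not> p x i" unfolding w_def by (rule not_less_Least)
        with g[of i x] show "\<exists>v>0. eval ?g [i, x] v" by auto
      qed
    qed
    then show "halts (Minim ?g) x" unfolding halts_def by blast
  qed
  then show ?thesis by blast
qed

section \<open>Finite sets and lists handled through their codes\<close>

lemma computable_div2: "computable (\<lambda>x. x div 2)"
proof -
  \<comment> \<open>The recursion rests on \<open>Suc n div 2 = n - n div 2\<close>, so no parity
    has to be tracked.\<close>
  have "rec_nat 0 (\<lambda>n y. n - y) k = k div 2" for k :: nat
    by (induction k) auto
  then show ?thesis
    using computable_rec_nat[of "\<lambda>x. x" "\<lambda>x. 0" "\<lambda>_ n y. n - y"]
    by (simp add: computable_id computable_const computable_diff computable_pfst computable_psnd)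
qed

lemma decidable_mem_set_decode:
  assumes "computable f" "computable g"
  shows "decidable (\<lambda>x. f x \<in> set_decode (g x))"
proof -
  \<comment> \<open>Membership of \<open>x\<close> is the parity of the code after \<open>x\<close>
    halvings.\<close>
  have *: "rec_nat s (\<lambda>_ y. y div 2) k = s div 2 ^ k" for k s :: nat
    by (induction k) (auto simp: div_mult2_eq power_Suc2 simp del: power_Suc)
  have c: "computable (\<lambda>x. g x div 2 ^ f x)"
    using computable_rec_nat[of f g "\<lambda>_ _ y. y div 2"] assms
    by (simp add: * computable_comp[OF computable_div2] computable_psnd computable_id)
  have "odd (y::nat) \<longleftrightarrow> y \<noteq> y div 2 + y div 2" for y by presburger
  then show ?thesis unfolding set_decode_def mem_Collect_eq
    using c computable_comp[OF computable_div2 c] by (simp only:) (intro decidable_not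
        decidable_eq computable_add)
qed

text \<open>A nonempty list is coded by the successor of a pair, so \<open>psnd (y - 1)\<close>
  codes the tail. The empty list, coded by 0, is a fixed point because
  \<open>prod_decode 0 = (0, 0)\<close>.\<close>

definition ldrop :: "nat \<Rightarrow> nat \<Rightarrow> nat" where
  "ldrop c i = rec_nat c (\<lambda>_ y. psnd (y - 1)) i"

lemma ldrop_list_encode: "ldrop (list_encode xs) i = list_encode (drop i xs)"
proof (induction i)
  case 0 show ?case by (simp add: ldrop_def)
next
  case (Suc i)
  have "list_encode (tl ys) = psnd (list_encode ys - 1)" for ys
    by (cases ys) (auto simp: prod_decode_0)
  from this[of "drop i xs"] Suc show ?case by (simp add: ldrop_def drop_Suc drop_tl)
qed

definition lnth :: "nat \<Rightarrow> nat \<Rightarrow> nat" where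
  "lnth c i = pfst (ldrop c i - 1)"

lemma lnth_list_encode: "i < length xs \<Longrightarrow> lnth (list_encode xs) i = xs ! i"
  unfolding lnth_def ldrop_list_encode by (simp flip: Cons_nth_drop_Suc)

lemma computable_ldrop: "computable f \<Longrightarrow> computable g \<Longrightarrow> computable (\<lambda>x. ldrop (f x) (g x))"
  unfolding ldrop_def by (intro computable_rec_nat computable_psnd computable_diff computable_id
      computable_const)

lemma computable_lnth: "computable f \<Longrightarrow> computable g \<Longrightarrow> computable (\<lambda>x. lnth (f x) (g x))"
  unfolding lnth_def by (intro computable_pfst computable_diff computable_const computable_ldrop)

text \<open>Lets the code of a list serve as the loop bound for running through it.\<close>

lemma length_le_list_encode: "length xs \<le> list_encode xs"
  by (induction xs) (auto intro: order_trans[OF _ le_prod_encode_2])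

lemma ball_list_decode:
  "(\<forall>y\<in>set (list_decode c). p y) \<longleftrightarrow> (\<forall>i<c. ldrop c i \<noteq> 0 \<longrightarrow> p (lnth c i))"
proof -
  obtain xs where c: "c = list_encode xs" using list_decode_inverse[of c, symmetric] by blast
  have z: "list_encode ys = 0 \<longleftrightarrow> ys = []" for ys by (cases ys) auto
  have "(\<forall>i<c. ldrop c i \<noteq> 0 \<longrightarrow> p (lnth c i)) \<longleftrightarrow> (\<forall>i<length xs. p (xs ! i))"
    using length_le_list_encode[of xs]
    by (auto simp: c ldrop_list_encode z lnth_list_encode)
  then show ?thesis by (simp add: c all_set_conv_all_nth)
qed

lemma decidable_ball_list_decode:
  assumes "computable f" "decidable (\<lambda>z. p (pfst z) (psnd z))"
  shows "decidable (\<lambda>x. \<forall>y\<in>set (list_decode (f x)). p x y)"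
proof -
  have 1: "computable (\<lambda>z. f (pfst z))" by (intro computable_comp[OF assms(1)] computable_pfst
      computable_id)
  have "computable (\<lambda>z. prod_encode (pfst z, lnth (f (pfst z)) (psnd z)))"
    by (intro 1 computable_pair computable_pfst computable_psnd computable_lnth computable_id)
  from computable_comp[OF assms(2)[unfolded decidable_def] this]
  have "decidable (\<lambda>z. p (pfst z) (lnth (f (pfst z)) (psnd z)))" by (simp add: decidable_def)
  then show ?thesis unfolding ball_list_decode
    by (intro decidable_all_less decidable_imp decidable_not decidable_eq assms computable_ldrop
        computable_const 1 computable_psnd computable_id)
qed

lemma decidable_bex_list_decode:
  assumes "computable f" "decidable (\<lambda>z. p (pfst z) (psnd z))"
  shows "decidable (\<lambda>x. \<exists>y\<in>set (list_decode (f x)). p x y)"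
  using decidable_not[OF decidable_ball_list_decode[OF assms(1) decidable_not[OF assms(2)]]] by simp

text \<open>The image is built from the end of the list: stage \<open>k\<close> holds the mapped
  suffix that starts at position \<open>f x - k\<close>. As a list is no longer than its code, stage
  0 is empty and stage \<open>f x\<close> is the whole list; positions past the end are recognized
  by \<open>d = 0\<close>.\<close>

lemma computable_map:
  assumes "computable f" "computable (\<lambda>z. g (pfst z) (psnd z))"
  shows "computable (\<lambda>x. list_encode (map (g x) (list_decode (f x))))"
proof -
  define h where "h = (\<lambda>x i y. let d = ldrop (f x) (f x - Suc i) in
    if d = 0 then 0 else Suc (prod_encode (g x (pfst (d - 1)), y)))"
  have *: "rec_nat 0 (h x) k = list_encode (map (g x) (drop (f x - k) (list_decode (f x))))"
    if "k \<le> f x" for x k using that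
  proof (induction k)
    case 0
    have "length (list_decode (f x)) \<le> f x"
      using length_le_list_encode[of "list_decode (f x)"] by simp
    then show ?case by simp
  next
    case (Suc k)
    let ?l = "list_decode (f x)" and ?j = "f x - Suc k"
    have j: "f x - k = Suc ?j" using Suc(2) by simp
    have d: "ldrop (f x) ?j = list_encode (drop ?j ?l)"
      using ldrop_list_encode[of ?l ?j] by simp
    show ?case
    proof (cases "?j < length ?l")
      case True
      then have "drop ?j ?l = ?l ! ?j # drop (f x - k) ?l"
        unfolding j by (rule Cons_nth_drop_Suc[symmetric])
      with Suc d show ?thesis by (simp add: h_def)
    next
      case False
      with d show ?thesis by (simp add: h_def)
    qed
  qed
  have 1: "computable (\<lambda>z. f (pfst z))" by (intro computable_comp[OF assms(1)] computable_pfst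
      computable_id)
  have d: "computable (\<lambda>z. ldrop (f (pfst z)) (f (pfst z) - Suc (pfst (psnd z))))"
    by (intro computable_ldrop 1 computable_diff computable_Suc computable_pfst computable_psnd
        computable_id)
  have "computable (\<lambda>z. prod_encode (pfst z, pfst (ldrop (f (pfst z)) (f (pfst z) - Suc (pfst
      (psnd z))) - 1)))"
    by (intro computable_pair d computable_pfst computable_diff computable_const computable_id)
  from computable_comp[OF assms(2) this]
  have "computable (\<lambda>z. h (pfst z) (pfst (psnd z)) (psnd (psnd z)))"
    unfolding h_def Let_def
    by (intro computable_if decidable_eq d computable_const computable_Suc computable_pair
        computable_psnd computable_id) simp
  then have "computable (\<lambda>x. rec_nat 0 (h x) (f x))"
    by (intro computable_rec_nat assms computable_const)
  then show ?thesis by (simp add: *)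
qed

lemma computable_length_list_decode:
  assumes "computable f" shows "computable (\<lambda>x. length (list_decode (f x)))"
proof -
  \<comment> \<open>The value is one more than the last position visited with a nonempty suffix, and
    it freezes once the list is exhausted.\<close>
  have *: "rec_nat 0 (\<lambda>i y. if ldrop c i = 0 then y else Suc i) k = min k (length (list_decode
      c))" for c k
  proof (induction k)
    case (Suc k)
    have "ldrop c k = list_encode (drop k (list_decode c))"
      using ldrop_list_encode[of "list_decode c" k] by simp
    moreover have "list_encode ys = 0 \<longleftrightarrow> ys = []" for ys by (cases ys) auto
    ultimately show ?case using Suc by auto
  qed simp
  have "length (list_decode c) \<le> c" for c
    using length_le_list_encode[of "list_decode c"] by simp
  with * have "length (list_decode c) = rec_nat 0 (\<lambda>i y. if ldrop c i = 0 then y else Suc i) c"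
      for c
    by (simp add: min_absorb2)
  moreover have "computable (\<lambda>x. rec_nat 0 (\<lambda>i y. if ldrop (f x) i = 0 then y else Suc i) (f x))"
    by (intro computable_rec_nat assms computable_const computable_if decidable_eq
        computable_ldrop computable_comp[OF assms] computable_Suc
        computable_pfst computable_psnd computable_id)
  ultimately show ?thesis by simp
qed

lemma computable_replicate:
  assumes "computable f" "computable g"
  shows "computable (\<lambda>x. list_encode (replicate (f x) (g x)))"
proof -
  have "list_encode (replicate k n) = rec_nat 0 (\<lambda>_ y. Suc (prod_encode (n, y))) k" for k n
    by (induction k) auto
  then show ?thesis
    by (simp only:) (intro computable_rec_nat assms computable_const computable_Suc
        computable_pair computable_psnd computable_comp[OF assms(2)] computable_pfst computable_id)
qed

text \<open>The table passed to \<open>G\<close> lists the values at \<open>n - 1, \<dots>, 0\<close>.\<close>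

lemma computable_course_of_values:
  assumes G: "computable (\<lambda>z. G (pfst z) (pfst (psnd z)) (psnd (psnd z)))"
    and F: "\<And>p n t. (\<And>m. m < n \<Longrightarrow> lnth t (n - Suc m) = F p m) \<Longrightarrow> G p n t = F p n"
    and "computable f" "computable g"
  shows "computable (\<lambda>x. F (f x) (g x))"
proof -
  \<comment> \<open>The newest value is at the front, so extending the table is a single
    cons.\<close>
  define tab where "tab = (\<lambda>p. rec_nat 0 (\<lambda>n t. Suc (prod_encode (G p n t, t))))"
  have tab: "tab p n = list_encode (rev (map (F p) [0..<n]))" for p n
  proof (induction n)
    case (Suc n)
    have "G p n (tab p n) = F p n"
    proof (rule F)
      fix m assume "m < n"
      then show "lnth (tab p n) (n - Suc m) = F p m"
        unfolding Suc by (subst lnth_list_encode) (auto simp: rev_nth)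
    qed
    with Suc show ?case by (simp add: tab_def)
  qed (simp add: tab_def)
  have "computable (\<lambda>x. tab (f x) (Suc (g x)))"
  proof -
    have "computable (\<lambda>z. prod_encode (f (pfst z), psnd z))"
      by (intro computable_pair computable_comp[OF assms(3)] computable_pfst computable_psnd
          computable_id)
    from computable_comp[OF G this]
    have "computable (\<lambda>z. G (f (pfst z)) (pfst (psnd z)) (psnd (psnd z)))" by simp
    then show ?thesis
      unfolding tab_def by (intro computable_rec_nat computable_Suc computable_pair assms
          computable_psnd computable_id computable_const)
  qed
  then have "computable (\<lambda>x. lnth (tab (f x) (Suc (g x))) 0)" by (intro computable_lnth
      computable_const)
  moreover have "lnth (tab p (Suc n)) 0 = F p n" for p n
    unfolding tab by (subst lnth_list_encode) auto
  ultimately show ?thesis by simp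
qed

section \<open>Splitting sets and compactness of stable models\<close>

text \<open>A ground rule: head, positive body and negative body, with atoms replaced by their codes.\<close>

type_synonym grule = "nat set \<times> nat set \<times> nat set"

text \<open>\<open>N\<close> is a model of the reduct of \<open>G\<close> by \<open>M\<close>.
  Keeping the reduct implicit allows both sets to be cut down to \<open>U\<close> together.\<close>

definition red_model :: "grule set \<Rightarrow> nat set \<Rightarrow> nat set \<Rightarrow> bool" where
  "red_model G M N \<longleftrightarrow> (\<forall>(H, B, C)\<in>G. C \<inter> M = {} \<longrightarrow> B \<subseteq> N \<longrightarrow> H \<inter> N \<noteq> {})"

definition stable_set :: "grule set \<Rightarrow> nat set \<Rightarrow> bool" where
  "stable_set G M \<longleftrightarrow> red_model G M M \<and> \<not> (\<exists>N. N \<subset> M \<and> red_model G M N)"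

definition meeting :: "grule set \<Rightarrow> nat set \<Rightarrow> grule set" where
  "meeting G U = {g \<in> G. fst g \<inter> U \<noteq> {}}"

text \<open>Splitting sets in the sense of Lifschitz and Turner. They give the dichotomy behind the
  next lemmas: a rule lies entirely inside \<open>U\<close>, or its head avoids
  \<open>U\<close>.\<close>

definition splitting :: "grule set \<Rightarrow> nat set \<Rightarrow> bool" where
  "splitting G U \<longleftrightarrow> (\<forall>(H, B, C)\<in>meeting G U. H \<union> B \<union> C \<subseteq> U)"

lemma red_modelD:
  "red_model G M N \<Longrightarrow> (H, B, C) \<in> G \<Longrightarrow> C \<inter> M = {} \<Longrightarrow> B \<subseteq> N \<Longrightarrow> H \<inter> N \<noteq> {}"
  unfolding red_model_def by fast

lemma splitsD: "splitting G U \<Longrightarrow> (H, B, C) \<in> meeting G U \<Longrightarrow> H \<union> B \<union> C \<subseteq> U"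
  unfolding splitting_def by fast

lemma red_model_meeting_Int:
  assumes "splitting G U" "red_model G M N"
  shows "red_model (meeting G U) (M \<inter> U) (N \<inter> U)"
  unfolding red_model_def
proof (safe)
  fix H B C assume g: "(H, B, C) \<in> meeting G U" and "C \<inter> (M \<inter> U) = {}" "B \<subseteq> N \<inter> U"
    and HN: "H \<inter> (N \<inter> U) = {}"
  moreover from splitsD[OF assms(1) g] have s: "H \<union> B \<union> C \<subseteq> U" .
  ultimately have "C \<inter> M = {}" "B \<subseteq> N" by blast+
  moreover have "(H, B, C) \<in> G" using g by (simp add: meeting_def)
  ultimately have "H \<inter> N \<noteq> {}" using red_modelD[OF assms(2)] by simp
  with s HN show False by blast
qed

text \<open>A smaller model \<open>N\<close> of the lower part would yield the smaller model
  \<open>N \<union> (M - U)\<close> of the whole. A rule meeting \<open>U\<close> sees only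
  \<open>N\<close>; for any other rule a true body is true in \<open>M\<close> as well, and the head
  atom that \<open>M\<close> provides lies outside \<open>U\<close>.\<close>

lemma stable_set_meeting_Int:
  assumes s: "splitting G U" and M: "stable_set G M"
  shows "stable_set (meeting G U) (M \<inter> U)"
  unfolding stable_set_def
proof (intro conjI notI)
  from M have M1: "red_model G M M" by (simp add: stable_set_def)
  from red_model_meeting_Int[OF s this] show "red_model (meeting G U) (M \<inter> U) (M \<inter> U)" .
  assume "\<exists>N. N \<subset> M \<inter> U \<and> red_model (meeting G U) (M \<inter> U) N"
  then obtain N where N: "N \<subset> M \<inter> U" "red_model (meeting G U) (M \<inter> U) N" by blast
  have "red_model G M (N \<union> (M - U))"
    unfolding red_model_def
  proof (safe)
    fix H B C assume g: "(H, B, C) \<in> G" "C \<inter> M = {}" "B \<subseteq> N \<union> (M - U)"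
      and no: "H \<inter> (N \<union> (M - U)) = {}"
    show False
    proof (cases "H \<inter> U = {}")
      case True
      from g N(1) have "B \<subseteq> M" by blast
      with red_modelD[OF M1 g(1,2)] have "H \<inter> M \<noteq> {}" by simp
      with True no show False by blast
    next
      case False
      then have r: "(H, B, C) \<in> meeting G U" using g by (simp add: meeting_def)
      from splitsD[OF s this] have "H \<union> B \<union> C \<subseteq> U" .
      with g have "C \<inter> (M \<inter> U) = {}" "B \<subseteq> N" by blast+
      with red_modelD[OF N(2) r] have "H \<inter> N \<noteq> {}" by simp
      with no show False by blast
    qed
  qed
  moreover have "N \<union> (M - U) \<subset> M" using N(1) by blast
  ultimately show False using M unfolding stable_set_def by blast
qed

lemma stable_set_subset_heads:
  assumes "stable_set G M" shows "M \<subseteq> \<Union> (fst ` G)"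
proof (rule ccontr)
  assume "\<not> ?thesis"
  then have "M \<inter> \<Union> (fst ` G) \<subset> M" by blast
  moreover have "red_model G M (M \<inter> \<Union> (fst ` G))"
    unfolding red_model_def
  proof safe
    fix H B C assume g: "(H, B, C) \<in> G" "C \<inter> M = {}" "B \<subseteq> M \<inter> \<Union> (fst ` G)"
      and no: "H \<inter> (M \<inter> \<Union> (fst ` G)) = {}"
    have "red_model G M M" using assms by (simp add: stable_set_def)
    with g have "H \<inter> M \<noteq> {}" by (blast dest: red_modelD)
    moreover have "H \<subseteq> \<Union> (fst ` G)" using g(1) by force
    ultimately show False using no by blast
  qed
  ultimately show False using assms unfolding stable_set_def by blast
qed

lemma meeting_meeting: "splitting G U \<Longrightarrow> V \<subseteq> U \<Longrightarrow> meeting (meeting G U) V = meeting G V"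
  unfolding meeting_def by blast

lemma splitting_meeting: "splitting G V \<Longrightarrow> splitting (meeting G U) V"
  unfolding splitting_def meeting_def by blast

lemma splitting_UN: "(\<And>i. i \<in> I \<Longrightarrow> splitting G (c i)) \<Longrightarrow> splitting G (\<Union>i\<in>I. c i)"
  unfolding splitting_def meeting_def by fastforce

text \<open>\<open>M\<close> is a cluster point of the sequence \<open>X\<close>. The nodes of the
  tree at level \<open>k\<close> are the traces on \<open>U k\<close> shared by infinitely many
  \<open>X j\<close>, and \<open>M\<close> is the union along a branch.\<close>

lemma koenig_sets:
  fixes U :: "nat \<Rightarrow> 'a set" and X :: "nat \<Rightarrow> 'a set"
  assumes fin: "\<And>k. finite (U k)" and mono: "\<And>k. U k \<subseteq> U (Suc k)"
  shows "\<exists>M. \<forall>k. \<exists>j\<ge>k. M \<inter> U k = X j \<inter> U k"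
proof -
  define Q where "Q k A \<longleftrightarrow> A \<subseteq> U k \<and> infinite {j. X j \<inter> U k = A}" for k A
  \<comment> \<open>Pigeonhole: infinitely many indices leave only finitely many traces on the
    finite set \<open>U k\<close>.\<close>
  have ex: "\<exists>A. A \<subseteq> U k \<and> infinite {j\<in>J. X j \<inter> U k = A}" if "infinite J" for J k
  proof (rule ccontr)
    assume "\<not> ?thesis"
    then have "finite (\<Union>A\<in>Pow (U k). {j\<in>J. X j \<inter> U k = A})" using fin by auto
    moreover have "J \<subseteq> (\<Union>A\<in>Pow (U k). {j\<in>J. X j \<inter> U k = A})"
    proof
      fix j assume "j \<in> J"
      then show "j \<in> (\<Union>A\<in>Pow (U k). {j\<in>J. X j \<inter> U k = A})"
        by (intro UN_I[of "X j \<inter> U k"]) simp_all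
    qed
    ultimately have "finite J" by (rule rev_finite_subset)
    with that show False by simp
  qed
  have "\<exists>f. \<forall>k. Q k (f k) \<and> f (Suc k) \<inter> U k = f k"
  proof (rule dependent_nat_choice)
    show "\<exists>A. Q 0 A" using ex[of UNIV 0] by (auto simp: Q_def)
  next
    fix A k assume "Q k A"
    then have "infinite {j. X j \<inter> U k = A}" by (simp add: Q_def)
    from ex[OF this, of "Suc k"] obtain A' where A': "A' \<subseteq> U (Suc k)"
      "infinite {j \<in> {j. X j \<inter> U k = A}. X j \<inter> U (Suc k) = A'}" by blast
    from infinite_imp_nonempty[OF A'(2)] obtain j where
      "X j \<inter> U k = A" "X j \<inter> U (Suc k) = A'" by blast
    then have "A' \<inter> U k = A" using mono[of k] by blast
    moreover have "infinite {j. X j \<inter> U (Suc k) = A'}"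
      using A'(2) by (rule contrapos_nn) (rule finite_subset[rotated], auto)
    ultimately show "\<exists>A'. Q (Suc k) A' \<and> A' \<inter> U k = A" using A'(1) by (auto simp: Q_def)
  qed
  then obtain f where f: "\<And>k. Q k (f k)" "\<And>k. f (Suc k) \<inter> U k = f k" by blast
  have ext: "f (k + d) \<inter> U k = f k" for k d
  proof (induction d)
    case 0 show ?case using f(1)[of k] by (auto simp: Q_def)
  next
    case (Suc d)
    have "U k \<subseteq> U (k + d)" by (rule lift_Suc_mono_le[of U, OF mono]) simp
    with Suc f(2)[of "k + d"] show ?case by auto
  qed
  have M: "(\<Union>i. f i) \<inter> U k = f k" for k
  proof
    show "f k \<subseteq> (\<Union>i. f i) \<inter> U k" using ext[of k 0] by auto
    show "(\<Union>i. f i) \<inter> U k \<subseteq> f k"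
    proof safe
      fix x i assume x: "x \<in> f i" "x \<in> U k"
      show "x \<in> f k"
      proof (cases "i \<le> k")
        case True then show ?thesis using ext[of i "k - i"] x by auto
      next
        case False then show ?thesis using ext[of k "i - k"] x by auto
      qed
    qed
  qed
  show ?thesis
  proof (rule exI[of _ "\<Union>i. f i"], rule allI)
    fix k
    have "infinite {j. X j \<inter> U k = f k}" using f(1) by (simp add: Q_def)
    then have "\<not> {j. X j \<inter> U k = f k} \<subseteq> {..<k}" using finite_subset[OF _ finite_lessThan] by blast
    then obtain j where "\<not> j < k" "X j \<inter> U k = f k" by blast
    then show "\<exists>j\<ge>k. (\<Union>i. f i) \<inter> U k = X j \<inter> U k" using M by (intro exI[of _ j]) simp
  qed
qed

text \<open>The covering sets are accumulated along the natural numbers to an increasing chain of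
  finite splitting sets, and a cluster point of stable sets of the stages is stable. Each violation
  of modelhood or minimality would already show at one stage.\<close>

lemma stable_set_compactness:
  assumes ne: "\<And>H B C. (H, B, C) \<in> G \<Longrightarrow> H \<noteq> {}"
    and cover: "\<And>x. \<exists>U. finite U \<and> splitting G U \<and> x \<in> U"
    and stable_set: "\<And>U. finite U \<Longrightarrow> splitting G U \<Longrightarrow> \<exists>M\<subseteq>U. stable_set (meeting G U) M"
  shows "\<exists>M. stable_set G M"
proof -
  from cover obtain c where c: "\<And>x. finite (c x)" "\<And>x. splitting G (c x)" "\<And>x. x \<in> c x" by metis
  define U where "U k = (\<Union>x\<in>{..k}. c x)" for k :: nat
  have U: "finite (U k)" "splitting G (U k)" "k \<in> U k" for k
    unfolding U_def using c by (auto intro: splitting_UN)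
  have mono: "i \<le> j \<Longrightarrow> U i \<subseteq> U j" for i j unfolding U_def by (auto intro: le_trans)
  from stable_set[OF U(1,2)] obtain X where X: "\<And>k. X k \<subseteq> U k" "\<And>k. stable_set (meeting G (U k))
      (X k)" by metis
  obtain M where M: "\<And>k. \<exists>j\<ge>k. M \<inter> U k = X j \<inter> U k"
    using koenig_sets[of U X] U(1) mono by (metis le_SucI order_refl)
  have MU: "stable_set (meeting G (U k)) (M \<inter> U k)" for k
  proof -
    obtain j where j: "j \<ge> k" "M \<inter> U k = X j \<inter> U k" using M by blast
    \<comment> \<open>Stability descends from stage \<open>j\<close> to stage \<open>k\<close>,
      because \<open>U k\<close> also splits the rules meeting \<open>U j\<close>.\<close>
    have "stable_set (meeting (meeting G (U j)) (U k)) (X j \<inter> U k)"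
      by (intro stable_set_meeting_Int splitting_meeting U X)
    then show ?thesis using meeting_meeting[OF U(2) mono[OF j(1)]] j(2) by simp
  qed
  have "red_model G M M"
    unfolding red_model_def
  proof safe
    fix H B C assume g: "(H, B, C) \<in> G" "C \<inter> M = {}" "B \<subseteq> M" "H \<inter> M = {}"
    \<comment> \<open>A head atom \<open>x\<close> places the rule among those meeting
      \<open>U x\<close>, so all its atoms lie in that one finite set.\<close>
    from ne[OF g(1)] obtain x where "x \<in> H" by blast
    with U(3)[of x] g have r: "(H, B, C) \<in> meeting G (U x)" by (auto simp: meeting_def)
    from splitsD[OF U(2) this] have "H \<union> B \<union> C \<subseteq> U x" .
    with g have "C \<inter> (M \<inter> U x) = {}" "B \<subseteq> M \<inter> U x" by blast+
    moreover have "red_model (meeting G (U x)) (M \<inter> U x) (M \<inter> U x)" using MU by (simp add: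
        stable_set_def)
    ultimately have "H \<inter> (M \<inter> U x) \<noteq> {}" using r red_modelD by blast
    with g show False by blast
  qed
  moreover have "\<not> red_model G M N" if "N \<subset> M" for N
  proof
    assume N: "red_model G M N"
    from that obtain x where x: "x \<in> M" "x \<notin> N" by blast
    \<comment> \<open>\<open>U x\<close> contains the lost atom \<open>x\<close>, so the inclusion
      stays proper after restriction.\<close>
    have "N \<inter> U x \<subset> M \<inter> U x" using that x U(3)[of x] by blast
    moreover from red_model_meeting_Int[OF U(2) N] have "red_model (meeting G (U x)) (M \<inter> U x) (N
        \<inter> U x)" .
    ultimately show False using MU[of x] unfolding stable_set_def by blast
  qed
  ultimately show ?thesis unfolding stable_set_def by blast
qed

lemma no_stable_set_iff_finite:
  assumes ne: "\<And>H B C. (H, B, C) \<in> G \<Longrightarrow> H \<noteq> {}"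
    and cover: "\<And>x. \<exists>U. finite U \<and> splitting G U \<and> x \<in> U"
  shows "\<not> (\<exists>M. stable_set G M) \<longleftrightarrow>
    (\<exists>U. finite U \<and> splitting G U \<and> (\<forall>M\<subseteq>U. \<not> stable_set (meeting G U) M))"
proof
  assume no: "\<not> (\<exists>M. stable_set G M)"
  show "\<exists>U. finite U \<and> splitting G U \<and> (\<forall>M\<subseteq>U. \<not> stable_set (meeting G U) M)"
  proof (rule ccontr)
    assume contra: "\<not> ?thesis"
    have "\<exists>M. stable_set G M"
    proof (rule stable_set_compactness)
      show "H \<noteq> {}" if "(H, B, C) \<in> G" for H B C using that by (rule ne)
      show "\<exists>U. finite U \<and> splitting G U \<and> x \<in> U" for x by (rule cover)
      show "\<exists>M\<subseteq>U. stable_set (meeting G U) M" if "finite U" "splitting G U" for U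
        using that contra by simp
    qed
    with no show False by contradiction
  qed
next
  assume "\<exists>U. finite U \<and> splitting G U \<and> (\<forall>M\<subseteq>U. \<not> stable_set (meeting G U) M)"
  then obtain U where U: "splitting G U" "\<And>M. M \<subseteq> U \<Longrightarrow> \<not> stable_set (meeting G U) M" by blast
  show "\<not> (\<exists>M. stable_set G M)"
  proof
    assume "\<exists>M. stable_set G M"
    then obtain M where "stable_set G M" by blast
    with U(2)[OF Int_lower2] stable_set_meeting_Int[OF U(1)] show False by simp
  qed
qed

section \<open>Witnesses of inconsistency\<close>

lemma mem_less_list_encode: "x \<in> set xs \<Longrightarrow> x < list_encode xs"
proof (induction xs)
  case (Cons y ys)
  have "y \<le> prod_encode (y, list_encode ys)" "list_encode ys \<le> prod_encode (y, list_encode ys)"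
    by (rule le_prod_encode_1, rule le_prod_encode_2)
  with Cons show ?case by auto
qed simp

lemma mem_list_decode_less: "x \<in> set (list_decode c) \<Longrightarrow> x < c"
  using mem_less_list_encode[of x "list_decode c"] by simp

lemma le_triangle: "m \<le> triangle m"
  by (induction m) auto

lemma pfst_le: "pfst x \<le> x"
  using le_prod_encode_1[of "pfst x" "psnd x"] by simp

lemma psnd_le: "psnd x \<le> x"
  using le_prod_encode_2[of "psnd x" "pfst x"] by simp

text \<open>With tag 0 this fails, since \<open>prod_encode (0, 0) = 0\<close>. Recursion on term
  codes descends only below a nonzero tag, which is exactly where function terms have
  arguments.\<close>

lemma psnd_less: assumes "pfst x \<noteq> 0" shows "psnd x < x"
proof -
  have "x = triangle (pfst x + psnd x) + pfst x"
    using pfst_psnd_collapse[of x] unfolding prod_encode_def split_conv by (rule sym)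
  with le_triangle[of "pfst x + psnd x"] assms show ?thesis by linarith
qed

lemma arg_less:
  assumes "pfst x \<noteq> 0" "z \<in> set (list_decode (psnd (psnd x)))"
  shows "z < x"
  using mem_list_decode_less[OF assms(2)] psnd_le[of "psnd x"] psnd_less[OF assms(1)] by linarith

section \<open>The witness test on codes\<close>

text \<open>Being total on numbers, this reads any nonzero tag as that of a function term;
  \<open>ground_code\<close> later insists on tag 1.\<close>

function subterm_code :: "nat \<Rightarrow> nat \<Rightarrow> bool" where
  "subterm_code y x \<longleftrightarrow> (if pfst x = 0 then y = x
     else y = x \<or> (\<exists>z\<in>set (list_decode (psnd (psnd x))). subterm_code y z))"
  by auto
termination by (relation "measure snd") (auto intro: arg_less)

function subst_trm_code :: "nat \<Rightarrow> nat \<Rightarrow> nat" where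
  "subst_trm_code s x = (if pfst x = 0 then lnth s (psnd x)
     else prod_encode (1, prod_encode (pfst (psnd x),
       list_encode (map (subst_trm_code s) (list_decode (psnd (psnd x)))))))"
  by auto
termination by (relation "measure snd") (auto intro: arg_less)

declare subterm_code.simps [simp del] subst_trm_code.simps [simp del]

definition subst_atom_code :: "nat \<Rightarrow> nat \<Rightarrow> nat" where
  "subst_atom_code s a = prod_encode (pfst a, list_encode (map (subst_trm_code s) (list_decode
      (psnd a))))"

definition prog_subterm_code :: "nat \<Rightarrow> nat \<Rightarrow> bool" where
  "prog_subterm_code e y \<longleftrightarrow> (\<exists>r\<in>set (list_decode e).
     (\<exists>a\<in>set (list_decode (pfst r)). \<exists>t\<in>set (list_decode (psnd a)). subterm_code y t) \<or>
     (\<exists>l\<in>set (list_decode (psnd r)). \<exists>t\<in>set (list_decode (psnd (psnd l))). subterm_code y t))"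

definition occurs :: "nat \<Rightarrow> nat \<Rightarrow> nat \<Rightarrow> bool" where
  "occurs e f k \<longleftrightarrow> (\<exists>y\<le>e. prog_subterm_code e y \<and> pfst y = 1 \<and> pfst (psnd y) = f \<and>
     length (list_decode (psnd (psnd y))) = k)"

definition in_lang :: "nat \<Rightarrow> nat \<Rightarrow> nat \<Rightarrow> bool" where
  "in_lang e f k \<longleftrightarrow> occurs e f k \<or> (f = 0 \<and> k = 0 \<and> \<not> (\<exists>c\<le>e. occurs e c 0))"

definition ground_code :: "nat \<Rightarrow> nat \<Rightarrow> bool" where
  "ground_code e t \<longleftrightarrow> (\<forall>y\<le>t. subterm_code y t \<longrightarrow> pfst y = 1 \<and>
     in_lang e (pfst (psnd y)) (length (list_decode (psnd (psnd y)))))"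

text \<open>Entry \<open>x\<close> of the list is the value at variable \<open>x\<close>. Length
  \<open>Suc e\<close> suffices because variable indices in a program do not exceed its code
  \<open>e\<close>.\<close>

definition valid_subst :: "nat \<Rightarrow> nat \<Rightarrow> nat \<Rightarrow> bool" where
  "valid_subst e n s \<longleftrightarrow> length (list_decode s) = Suc e \<and>
     (\<forall>t\<in>set (list_decode s). t \<le> n \<and> ground_code e t)"

text \<open>Pairing is monotone, so no list of \<open>Suc e\<close> entries up to \<open>n\<close>
  has a larger code. This bounds the quantifier over substitutions.\<close>

definition subst_bound :: "nat \<Rightarrow> nat \<Rightarrow> nat" where
  "subst_bound e n = list_encode (replicate (Suc e) n)"

definition meets :: "nat \<Rightarrow> nat \<Rightarrow> nat \<Rightarrow> bool" where
  "meets s r u \<longleftrightarrow> (\<exists>a\<in>set (list_decode (pfst r)). subst_atom_code s a \<in> set_decode u)"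

definition splitting_code :: "nat \<Rightarrow> nat \<Rightarrow> nat \<Rightarrow> bool" where
  "splitting_code e n u \<longleftrightarrow> (\<forall>s\<le>subst_bound e n. valid_subst e n s \<longrightarrow>
     (\<forall>r\<in>set (list_decode e). meets s r u \<longrightarrow>
       (\<forall>a\<in>set (list_decode (pfst r)). subst_atom_code s a \<in> set_decode u) \<and>
       (\<forall>l\<in>set (list_decode (psnd r)). subst_atom_code s (psnd l) \<in> set_decode u)))"

definition model_code :: "nat \<Rightarrow> nat \<Rightarrow> nat \<Rightarrow> nat \<Rightarrow> nat \<Rightarrow> bool" where
  "model_code e n u m k \<longleftrightarrow> (\<forall>s\<le>subst_bound e n. valid_subst e n s \<longrightarrow>
     (\<forall>r\<in>set (list_decode e). meets s r u \<longrightarrow>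
       (\<forall>l\<in>set (list_decode (psnd r)). pfst l = 1 \<longrightarrow> subst_atom_code s (psnd l) \<notin> set_decode m) \<longrightarrow>
       (\<forall>l\<in>set (list_decode (psnd r)). pfst l = 0 \<longrightarrow> subst_atom_code s (psnd l) \<in> set_decode k) \<longrightarrow>
       meets s r k))"

definition subset_code :: "nat \<Rightarrow> nat \<Rightarrow> bool" where
  "subset_code m u \<longleftrightarrow> (\<forall>x<m. x \<in> set_decode m \<longrightarrow> x \<in> set_decode u)"

definition stable_set_code :: "nat \<Rightarrow> nat \<Rightarrow> nat \<Rightarrow> nat \<Rightarrow> bool" where
  "stable_set_code e n u m \<longleftrightarrow> model_code e n u m m \<and>
     \<not> (\<exists>k\<le>m. subset_code k m \<and> k \<noteq> m \<and> model_code e n u m k)"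

text \<open>The code bound \<open>u + e + 2\<close> covers the subterms of atoms in \<open>u\<close>, the constants of
  \<open>e\<close>, and the code 2 of the default constant.\<close>

definition refutes :: "nat \<Rightarrow> nat \<Rightarrow> bool" where
  "refutes e u \<longleftrightarrow> splitting_code e (u + e + 2) u \<and>
     (\<forall>m\<le>u. subset_code m u \<longrightarrow> \<not> stable_set_code e (u + e + 2) u m)"

section \<open>Decidability of the witness test\<close>

lemmas computable_intros =
  computable_id computable_Suc computable_add computable_diff computable_pair computable_pfst
      computable_psnd computable_if computable_lnth computable_map
  computable_length_list_decode computable_replicate
  decidable_not decidable_conj decidable_disj decidable_imp decidable_if decidable_eq decidable_le
      decidable_all_less decidable_all_le decidable_ex_less decidable_ex_le
  decidable_ball_list_decode decidable_bex_list_decode decidable_mem_set_decode computable_const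
      decidable_const

text \<open>Course-of-values recursion on the second argument: each recursive call becomes a table
  lookup, valid because arguments have smaller codes than the term.\<close>

lemma decidable_subterm_code: assumes "computable f" "computable g" shows "decidable (\<lambda>x.
    subterm_code (f x) (g x))"
  unfolding decidable_def
proof (rule computable_course_of_values[OF _ _ assms])
  let ?G = "\<lambda>p n t. if pfst n = 0 then p = n
     else p = n \<or> (\<exists>z\<in>set (list_decode (psnd (psnd n))). lnth t (n - Suc z) = 1)"
  show "computable (\<lambda>z. of_bool (?G (pfst z) (pfst (psnd z)) (psnd (psnd z))))"
    unfolding decidable_def[symmetric] by (intro computable_intros)
  fix p n t :: nat
  assume t: "\<And>m. m < n \<Longrightarrow> lnth t (n - Suc m) = of_bool (subterm_code p m)"
  show "of_bool (?G p n t) = (of_bool (subterm_code p n) :: nat)"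
  proof (cases "pfst n = 0")
    case True
    then show ?thesis by (simp add: subterm_code.simps[of p n])
  next
    case False
    then have "lnth t (n - Suc z) = of_bool (subterm_code p z)" if "z \<in> set (list_decode (psnd
        (psnd n)))" for z
      using t[OF arg_less] that by simp
    with False show ?thesis by (simp add: subterm_code.simps[of p n])
  qed
qed

lemma computable_subst_trm_code: assumes "computable f" "computable g" shows "computable (\<lambda>x.
    subst_trm_code (f x) (g x))"
proof (rule computable_course_of_values[OF _ _ assms])
  let ?G = "\<lambda>p n t. if pfst n = 0 then lnth p (psnd n)
     else prod_encode (1, prod_encode (pfst (psnd n),
       list_encode (map (\<lambda>z. lnth t (n - Suc z)) (list_decode (psnd (psnd n))))))"
  show "computable (\<lambda>z. ?G (pfst z) (pfst (psnd z)) (psnd (psnd z)))"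
    by (intro computable_intros)
  fix p n t :: nat
  assume t: "\<And>m. m < n \<Longrightarrow> lnth t (n - Suc m) = subst_trm_code p m"
  show "?G p n t = subst_trm_code p n"
  proof (cases "pfst n = 0")
    case True
    then show ?thesis by (simp add: subst_trm_code.simps[of p n])
  next
    case False
    then have "lnth t (n - Suc z) = subst_trm_code p z" if "z \<in> set (list_decode (psnd (psnd n)))"
        for z
      using t[OF arg_less] that by simp
    with False show ?thesis by (simp add: subst_trm_code.simps[of p n] cong: map_cong)
  qed
qed

lemma computable_subst_atom_code: assumes "computable f" "computable g" shows "computable (\<lambda>x.
    subst_atom_code (f x) (g x))"
  unfolding subst_atom_code_def by (intro computable_intros computable_subst_trm_code assms[THEN
      computable_comp] assms)

lemma decidable_prog_subterm_code: assumes "computable f" "computable g" shows "decidable (\<lambda>x.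
    prog_subterm_code (f x) (g x))"
  unfolding prog_subterm_code_def by (intro computable_intros decidable_subterm_code assms[THEN
      computable_comp] assms)

lemma decidable_occurs:
  assumes "computable f" "computable g" "computable h" shows "decidable (\<lambda>x. occurs (f x) (g x) (h
      x))"
  unfolding occurs_def by (intro computable_intros decidable_prog_subterm_code assms[THEN
      computable_comp] assms)

lemma decidable_in_lang:
  assumes "computable f" "computable g" "computable h" shows "decidable (\<lambda>x. in_lang (f x) (g x)
      (h x))"
  unfolding in_lang_def by (intro computable_intros decidable_occurs assms[THEN computable_comp]
      assms)

lemma decidable_ground_code: assumes "computable f" "computable g" shows "decidable (\<lambda>x.
    ground_code (f x) (g x))"
  unfolding ground_code_def by (intro computable_intros decidable_in_lang decidable_subterm_code
      assms[THEN computable_comp] assms)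

lemma decidable_valid_subst:
  assumes "computable f" "computable g" "computable h" shows "decidable (\<lambda>x. valid_subst (f x) (g
      x) (h x))"
  unfolding valid_subst_def by (intro computable_intros decidable_ground_code assms[THEN
      computable_comp] assms)

lemma computable_subst_bound: "computable f \<Longrightarrow> computable g \<Longrightarrow> computable (\<lambda>x. subst_bound (f x) (g
    x))"
  unfolding subst_bound_def by (intro computable_intros)

lemma decidable_meets:
  assumes "computable f" "computable g" "computable h" shows "decidable (\<lambda>x. meets (f x) (g x) (h
      x))"
  unfolding meets_def by (intro computable_intros computable_subst_atom_code assms[THEN
      computable_comp] assms)

lemma decidable_splitting_code:
  assumes "computable f" "computable g" "computable h" shows "decidable (\<lambda>x. splitting_code (f x)
      (g x) (h x))"
  unfolding splitting_code_def
  by (intro computable_intros computable_subst_atom_code computable_subst_bound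
      decidable_valid_subst decidable_meets assms[THEN computable_comp] assms)

lemma decidable_model_code:
  assumes "computable f" "computable g" "computable h" "computable i" "computable j"
  shows "decidable (\<lambda>x. model_code (f x) (g x) (h x) (i x) (j x))"
  unfolding model_code_def
  by (intro computable_intros computable_subst_atom_code computable_subst_bound
      decidable_valid_subst decidable_meets assms[THEN computable_comp] assms)

lemma decidable_subset_code: assumes "computable f" "computable g" shows "decidable (\<lambda>x.
    subset_code (f x) (g x))"
  unfolding subset_code_def by (intro computable_intros assms[THEN computable_comp] assms)

lemma decidable_stable_set_code:
  assumes "computable f" "computable g" "computable h" "computable i"
  shows "decidable (\<lambda>x. stable_set_code (f x) (g x) (h x) (i x))"
  unfolding stable_set_code_def
  by (intro computable_intros decidable_subset_code decidable_model_code assms[THEN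
      computable_comp] assms)

lemma decidable_refutes: assumes "computable f" "computable g" shows "decidable (\<lambda>x. refutes (f x)
    (g x))"
  unfolding refutes_def
  by (intro computable_intros decidable_subset_code decidable_splitting_code
      decidable_stable_set_code assms[THEN computable_comp] assms)

lemma refutes_search: "\<exists>f. \<forall>e. halts f e \<longleftrightarrow> (\<exists>u. refutes e u)"
  by (rule halts_search) (intro decidable_refutes computable_intros)

section \<open>Encoded programs\<close>

definition code_rule :: "nat \<Rightarrow> nat \<Rightarrow> grule" where
  "code_rule s r = (subst_atom_code s ` set (list_decode (pfst r)),
     {subst_atom_code s (psnd l) | l. l \<in> set (list_decode (psnd r)) \<and> pfst l = 0},
     {subst_atom_code s (psnd l) | l. l \<in> set (list_decode (psnd r)) \<and> pfst l = 1})"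

definition code_rules :: "nat \<Rightarrow> nat \<Rightarrow> grule set" where
  "code_rules e n = {code_rule s r | s r. valid_subst e n s \<and> r \<in> set (list_decode e)}"

lemma triangle_mono: "m \<le> n \<Longrightarrow> triangle m \<le> triangle n"
  by (rule lift_Suc_mono_le[of triangle]) auto

lemma prod_encode_mono: "a \<le> a' \<Longrightarrow> b \<le> b' \<Longrightarrow> prod_encode (a, b) \<le> prod_encode (a', b')"
  unfolding prod_encode_def split_conv by (intro add_mono triangle_mono)

lemma list_encode_le_replicate:
  "(\<And>t. t \<in> set ts \<Longrightarrow> t \<le> n) \<Longrightarrow> list_encode ts \<le> list_encode (replicate (length ts) n)"
  by (induction ts) (auto intro: prod_encode_mono)

lemma valid_subst_le: "valid_subst e n s \<Longrightarrow> s \<le> subst_bound e n"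
  using list_encode_le_replicate[of "list_decode s" n]
  unfolding valid_subst_def subst_bound_def by simp

lemma meets_iff: "meets s r u \<longleftrightarrow> fst (code_rule s r) \<inter> set_decode u \<noteq> {}"
  unfolding meets_def code_rule_def by auto

text \<open>The common shape of \<open>splitting_code\<close> and \<open>model_code\<close>. The
  bound on \<open>s\<close> excludes nothing, by \<open>valid_subst_le\<close>.\<close>

lemma ball_meeting_code_rules:
  "(\<forall>g\<in>meeting (code_rules e n) (set_decode u). Q g) \<longleftrightarrow>
     (\<forall>s\<le>subst_bound e n. valid_subst e n s \<longrightarrow>
       (\<forall>r\<in>set (list_decode e). meets s r u \<longrightarrow> Q (code_rule s r)))"
  unfolding meeting_def code_rules_def meets_iff
  by (blast dest: valid_subst_le)

text \<open>The assumption on tags reconciles the two sides: \<open>splitting_code\<close> inspects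
  all body literals, whereas \<open>code_rule\<close> collects only those tagged 0 or 1.\<close>

lemma splitting_code_iff:
  assumes "\<And>r l. r \<in> set (list_decode e) \<Longrightarrow> l \<in> set (list_decode (psnd r)) \<Longrightarrow> pfst l = 0 \<or> pfst l = 1"
  shows "splitting_code e n u \<longleftrightarrow> splitting (code_rules e n) (set_decode u)"
proof -
  let ?Q = "\<lambda>(H, B, C). H \<union> B \<union> C \<subseteq> set_decode u"
  have "?Q (code_rule s r) \<longleftrightarrow> (\<forall>a\<in>set (list_decode (pfst r)). subst_atom_code s a \<in> set_decode u) \<and>
       (\<forall>l\<in>set (list_decode (psnd r)). subst_atom_code s (psnd l) \<in> set_decode u)"
    if "r \<in> set (list_decode e)" for r s
    using assms[OF that] unfolding code_rule_def split_conv by blast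
  then show ?thesis unfolding splitting_def ball_meeting_code_rules splitting_code_def
    by (simp cong: ball_cong)
qed

lemma model_code_iff:
  "model_code e n u m k \<longleftrightarrow>
     red_model (meeting (code_rules e n) (set_decode u)) (set_decode m) (set_decode k)"
proof -
  let ?Q = "\<lambda>(H, B, C). C \<inter> set_decode m = {} \<longrightarrow> B \<subseteq> set_decode k \<longrightarrow> H \<inter> set_decode k \<noteq> {}"
  have "?Q (code_rule s r) \<longleftrightarrow>
      ((\<forall>l\<in>set (list_decode (psnd r)). pfst l = 1 \<longrightarrow> subst_atom_code s (psnd l) \<notin> set_decode m) \<longrightarrow>
       (\<forall>l\<in>set (list_decode (psnd r)). pfst l = 0 \<longrightarrow> subst_atom_code s (psnd l) \<in> set_decode k) \<longrightarrow>
       meets s r k)" for r s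
    unfolding code_rule_def split_conv meets_def by blast
  then show ?thesis unfolding red_model_def ball_meeting_code_rules model_code_def by simp
qed

lemma mem_set_decode_less: "x \<in> set_decode m \<Longrightarrow> x < m"
proof -
  assume "x \<in> set_decode m"
  then have "m div 2 ^ x \<noteq> 0" unfolding set_decode_def by (auto intro: ccontr)
  then have "2 ^ x \<le> m" by (simp add: div_eq_0_iff)
  with less_exp[of x] show "x < m" by (rule less_le_trans)
qed

lemma subset_code_iff: "subset_code m u \<longleftrightarrow> set_decode m \<subseteq> set_decode u"
  unfolding subset_code_def using mem_set_decode_less by blast

lemma set_decode_ex: "finite U \<Longrightarrow> \<exists>u. U = set_decode u"
  by (metis set_encode_inverse)

text \<open>Searching only \<open>k \<le> m\<close> is enough, since a subset of a finite set has a
  code that is no larger; distinct codes give distinct sets.\<close>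

lemma stable_set_code_iff:
  "stable_set_code e n u m \<longleftrightarrow> stable_set (meeting (code_rules e n) (set_decode u)) (set_decode m)"
proof -
  let ?G = "meeting (code_rules e n) (set_decode u)"
  have "(\<exists>k\<le>m. subset_code k m \<and> k \<noteq> m \<and> model_code e n u m k) \<longleftrightarrow>
    (\<exists>N. N \<subset> set_decode m \<and> red_model ?G (set_decode m) N)" (is "?l \<longleftrightarrow> ?r")
  proof
    assume ?l
    then obtain k where k: "set_decode k \<subseteq> set_decode m" "k \<noteq> m" "red_model ?G (set_decode m)
        (set_decode k)"
      unfolding subset_code_iff model_code_iff by blast
    moreover from k(2) have "set_decode k \<noteq> set_decode m"
      by (metis set_decode_inverse)
    ultimately show ?r by blast
  next
    assume ?r
    then obtain N where N: "N \<subset> set_decode m" "red_model ?G (set_decode m) N" by blast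
    then have "finite N" using finite_subset[of N "set_decode m"] by auto
    then obtain k where "N = set_decode k" using set_decode_ex by blast
    with N show ?l unfolding subset_code_iff model_code_iff
      by (intro exI[of _ k]) (auto intro: subset_decode_imp_le)
  qed
  then show ?thesis unfolding stable_set_code_def stable_set_def model_code_iff by simp
qed

lemma refutes_iff:
  assumes "\<And>r l. r \<in> set (list_decode e) \<Longrightarrow> l \<in> set (list_decode (psnd r)) \<Longrightarrow> pfst l = 0 \<or> pfst l = 1"
  shows "refutes e u \<longleftrightarrow> splitting (code_rules e (u + e + 2)) (set_decode u) \<and>
    (\<forall>M\<subseteq>set_decode u. \<not> stable_set (meeting (code_rules e (u + e + 2)) (set_decode u)) M)"
proof -
  have "(\<forall>m\<le>u. subset_code m u \<longrightarrow> \<not> stable_set_code e n u m) \<longleftrightarrow>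
    (\<forall>M\<subseteq>set_decode u. \<not> stable_set (meeting (code_rules e n) (set_decode u)) M)" (is "?l \<longleftrightarrow> ?r")
        for n
  proof
    assume l: ?l
    show ?r
    proof (intro allI impI)
      fix M assume M: "M \<subseteq> set_decode u"
      then have "finite M" using finite_subset[of M "set_decode u"] by auto
      then obtain m where "M = set_decode m" using set_decode_ex by blast
      with l M show "\<not> stable_set (meeting (code_rules e n) (set_decode u)) M"
        unfolding subset_code_iff stable_set_code_iff by (simp add: subset_decode_imp_le)
    qed
  qed (simp add: subset_code_iff stable_set_code_iff)
  moreover have "splitting_code e n u \<longleftrightarrow> splitting (code_rules e n) (set_decode u)" for n
    by (rule splitting_code_iff) (rule assms)
  ultimately show ?thesis unfolding refutes_def by simp
qed

section \<open>Terms, signatures and the Herbrand universe seen through codes\<close>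

fun subterms :: "trm \<Rightarrow> trm set" where
  "subterms (Var x) = {Var x}"
| "subterms (Fn f ts) = insert (Fn f ts) (\<Union>t\<in>set ts. subterms t)"

fun args :: "atom \<Rightarrow> trm list" where
  "args (Atom p ts) = ts"

definition atom_vars :: "atom \<Rightarrow> nat set" where
  "atom_vars a = {x. \<exists>t\<in>set (args a). Var x \<in> subterms t}"

lemma subterms_refl: "t \<in> subterms t"
  by (cases t) auto

lemma enc_trm_inject: "enc_trm t = enc_trm t' \<longleftrightarrow> t = t'"
proof
  show "enc_trm t = enc_trm t' \<Longrightarrow> t = t'"
  proof (induction t arbitrary: t')
    case (Var x)
    then show ?case by (cases t') (auto simp: prod_encode_eq)
  next
    case (Fn f ts)
    then obtain ts' where t': "t' = Fn f ts'" "map enc_trm ts = map enc_trm ts'"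
      by (cases t') (auto simp: prod_encode_eq list_encode_eq)
    have "ts = ts'"
    proof (rule nth_equalityI)
      show "length ts = length ts'" using t'(2) by (rule map_eq_imp_length_eq)
      fix i assume i: "i < length ts"
      then have "enc_trm (ts ! i) = enc_trm (ts' ! i)"
        using t'(2) \<open>length ts = length ts'\<close> by (metis nth_map)
      with i show "ts ! i = ts' ! i" by (intro Fn.IH) auto
    qed
    with t' show ?case by simp
  qed
qed simp

lemma inj_enc_trm: "inj enc_trm"
  by (rule injI) (simp add: enc_trm_inject)

lemma enc_atom_inject: "enc_atom a = enc_atom b \<longleftrightarrow> a = b"
  by (cases a; cases b) (auto simp: prod_encode_eq list_encode_eq inj_map_eq_map[OF inj_enc_trm])

lemma inj_enc_atom: "inj enc_atom"
  by (rule injI) (simp add: enc_atom_inject)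

lemma subterm_code_enc_trm: "subterm_code y (enc_trm t) \<longleftrightarrow> y \<in> enc_trm ` subterms t"
  by (induction t) (auto simp: subterm_code.simps)

lemma subterm_code_le: "subterm_code y x \<Longrightarrow> y \<le> x"
proof (induction y x rule: subterm_code.induct)
  case (1 y x)
  show ?case
  proof (cases "y = x")
    case False
    with 1(2) obtain z where z: "pfst x \<noteq> 0" "z \<in> set (list_decode (psnd (psnd x)))" "subterm_code
        y z"
      by (auto simp: subterm_code.simps[of y x] split: if_splits)
    with 1(1)[OF z] arg_less[OF z(1,2)] show ?thesis by simp
  qed simp
qed

text \<open>Justifies the bounds \<open>y \<le> e\<close> and \<open>c \<le> e\<close> in
  \<open>occurs\<close> and \<open>in_lang\<close>.\<close>

lemma prog_subterm_code_le: assumes "prog_subterm_code e y" shows "y \<le> e"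
proof -
  obtain r where r: "r < e" and "(\<exists>a\<in>set (list_decode (pfst r)). \<exists>t\<in>set (list_decode (psnd a)).
      subterm_code y t) \<or>
     (\<exists>l\<in>set (list_decode (psnd r)). \<exists>t\<in>set (list_decode (psnd (psnd l))). subterm_code y t)"
    using assms unfolding prog_subterm_code_def by (meson mem_list_decode_less)
  then show ?thesis
  proof (elim disjE bexE)
    fix a t assume "a \<in> set (list_decode (pfst r))" "t \<in> set (list_decode (psnd a))" "subterm_code
        y t"
    then have "a < pfst r" "t < psnd a" "y \<le> t"
      by (auto intro: mem_list_decode_less subterm_code_le)
    with r pfst_le[of r] psnd_le[of a] show ?thesis by linarith
  next
    fix l t assume "l \<in> set (list_decode (psnd r))" "t \<in> set (list_decode (psnd (psnd l)))"
        "subterm_code y t"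
    then have "l < psnd r" "t < psnd (psnd l)" "y \<le> t"
      by (auto intro: mem_list_decode_less subterm_code_le)
    with r psnd_le[of r] psnd_le[of l] psnd_le[of "psnd l"] show ?thesis by linarith
  qed
qed

lemma enc_atom_args: "list_decode (psnd (enc_atom a)) = map enc_trm (args a)"
  by (cases a) simp

lemma enc_rule_simps:
  "list_decode (pfst (enc_rule r)) = map enc_atom (head r)"
  "list_decode (psnd (enc_rule r)) = map enc_lit (body r)"
  by (cases r; simp)+

lemma psnd_enc_lit: "psnd (enc_lit l) = enc_atom (lit_atom l)"
  by (cases l) auto

lemma list_decode_enc_prog: "list_decode (enc_prog P) = map enc_rule P"
  by (simp add: enc_prog_def)

lemma prog_subterm_code_enc_prog:
  "prog_subterm_code (enc_prog P) y \<longleftrightarrow>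
     (\<exists>r\<in>set P. \<exists>a\<in>rule_atoms r. \<exists>t\<in>set (args a). \<exists>s\<in>subterms t. y = enc_trm s)"
  unfolding prog_subterm_code_def list_decode_enc_prog
  by (simp add: enc_rule_simps psnd_enc_lit enc_atom_args subterm_code_enc_trm rule_atoms_def
      image_iff bex_Un)

lemma fsyms_trm_eq: "fsyms_trm t = {(f, length ts) | f ts. Fn f ts \<in> subterms t}"
  by (induction t) auto

lemma fsyms_prog_iff:
  "(f, k) \<in> fsyms_prog P \<longleftrightarrow>
     (\<exists>ts. prog_subterm_code (enc_prog P) (enc_trm (Fn f ts)) \<and> length ts = k)"
proof -
  have "fsyms_atom a = (\<Union>t\<in>set (args a). fsyms_trm t)" for a by (cases a) simp
  then show ?thesis
    unfolding fsyms_prog_def prog_subterm_code_enc_prog enc_trm_inject fsyms_trm_eq by auto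
qed

lemma occurs_enc_prog: "occurs (enc_prog P) f k \<longleftrightarrow> (f, k) \<in> fsyms_prog P"
proof
  assume "occurs (enc_prog P) f k"
  then obtain y where y: "prog_subterm_code (enc_prog P) y" "pfst y = 1" "pfst (psnd y) = f"
    "length (list_decode (psnd (psnd y))) = k" unfolding occurs_def by blast
  from y(1) obtain s where s: "y = enc_trm s" unfolding prog_subterm_code_enc_prog by blast
  with y(2) obtain g ts where "s = Fn g ts" by (cases s) auto
  with y s show "(f, k) \<in> fsyms_prog P" unfolding fsyms_prog_iff by auto
next
  assume "(f, k) \<in> fsyms_prog P"
  then obtain ts where "prog_subterm_code (enc_prog P) (enc_trm (Fn f ts))" "length ts = k"
    unfolding fsyms_prog_iff by blast
  then show "occurs (enc_prog P) f k" unfolding occurs_def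
    by (intro exI[of _ "enc_trm (Fn f ts)"]) (auto dest: prog_subterm_code_le)
qed

lemma in_lang_enc_prog: "in_lang (enc_prog P) f k \<longleftrightarrow> (f, k) \<in> lang_fsyms P"
proof -
  have "(\<exists>c\<le>enc_prog P. occurs (enc_prog P) c 0) \<longleftrightarrow> (\<exists>c. (c, 0) \<in> fsyms_prog P)"
  proof -
    have "c \<le> enc_prog P" if "(c, 0) \<in> fsyms_prog P" for c
    proof -
      obtain ts where "prog_subterm_code (enc_prog P) (enc_trm (Fn c ts))"
        using \<open>(c, 0) \<in> fsyms_prog P\<close> unfolding fsyms_prog_iff by blast
      then have "enc_trm (Fn c ts) \<le> enc_prog P" by (rule prog_subterm_code_le)
      moreover have "c \<le> enc_trm (Fn c ts)"
        using le_prod_encode_1 le_prod_encode_2 order_trans by (metis enc_trm.simps(2))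
      ultimately show ?thesis by simp
    qed
    then show ?thesis unfolding occurs_enc_prog by blast
  qed
  then show ?thesis unfolding in_lang_def lang_fsyms_def occurs_enc_prog by auto
qed

lemma subterms_herbrand:
  assumes "u \<in> herbrand_universe P" "s \<in> subterms u"
  shows "\<exists>f ts. s = Fn f ts \<and> (f, length ts) \<in> lang_fsyms P"
  using assms by (induction u) auto

text \<open>An arbitrary number has to be recognized as a term code. Strong induction rebuilds the
  term from its argument codes; tag 1 at every subterm excludes variables and numbers that code no
  term.\<close>

lemma ground_code_enc_prog:
  "ground_code (enc_prog P) t \<longleftrightarrow> (\<exists>u\<in>herbrand_universe P. t = enc_trm u)"
proof
  assume "ground_code (enc_prog P) t"
  then show "\<exists>u\<in>herbrand_universe P. t = enc_trm u"
  proof (induction t rule: less_induct)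
    case (less t)
    let ?f = "pfst (psnd t)" and ?l = "list_decode (psnd (psnd t))"
    have "subterm_code t t" by (simp add: subterm_code.simps)
    with less.prems have t: "pfst t = 1" "(?f, length ?l) \<in> lang_fsyms P"
      unfolding ground_code_def in_lang_enc_prog by auto
    have "\<exists>u\<in>herbrand_universe P. z = enc_trm u" if z: "z \<in> set ?l" for z
    proof (rule less.IH)
      show "z < t" using t(1) z by (intro arg_less) auto
      have "subterm_code y t" if "subterm_code y z" for y
        using that z t(1) by (auto simp: subterm_code.simps[of y t])
      then show "ground_code (enc_prog P) z"
        using less.prems subterm_code_le unfolding ground_code_def by blast
    qed
    then obtain w where w: "\<And>z. z \<in> set ?l \<Longrightarrow> w z \<in> herbrand_universe P \<and> z = enc_trm (w z)"
      by metis
    have "Fn ?f (map w ?l) \<in> herbrand_universe P"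
      by (rule herbrand_universe.intros) (use t(2) w in auto)
    moreover have "map enc_trm (map w ?l) = ?l"
      unfolding map_map by (rule map_idI) (use w in simp)
    then have "enc_trm (Fn ?f (map w ?l)) = prod_encode (1, psnd t)"
      by (simp del: map_map)
    with pfst_psnd_collapse[of t] t(1) have "t = enc_trm (Fn ?f (map w ?l))" by (simp only:)
    ultimately show ?case by (intro bexI)
  qed
next
  assume "\<exists>u\<in>herbrand_universe P. t = enc_trm u"
  then obtain u where u: "u \<in> herbrand_universe P" "t = enc_trm u" by blast
  show "ground_code (enc_prog P) t"
    unfolding ground_code_def in_lang_enc_prog
  proof (intro allI impI)
    fix y assume "subterm_code y t"
    then obtain s where s: "s \<in> subterms u" "y = enc_trm s" unfolding u(2) subterm_code_enc_trm by
        blast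
    from subterms_herbrand[OF u(1) s(1)] s(2) show "pfst y = 1 \<and>
      (pfst (psnd y), length (list_decode (psnd (psnd y)))) \<in> lang_fsyms P" by auto
  qed
qed


section \<open>Substitutions and ground instances\<close>

lemma subst_trm_cong:
  "(\<And>x. Var x \<in> subterms t \<Longrightarrow> \<sigma> x = \<tau> x) \<Longrightarrow> subst_trm \<sigma> t = subst_trm \<tau> t"
  by (induction t) auto

text \<open>Lifted to atoms, this makes the instances of an atom under different values of one of
  its variables pairwise distinct.\<close>

lemma subst_trm_eqD:
  "subst_trm \<sigma> t = subst_trm \<tau> t \<Longrightarrow> Var x \<in> subterms t \<Longrightarrow> \<sigma> x = \<tau> x"
  by (induction t) auto

lemma subst_atom_cong:
  "(\<And>x. x \<in> atom_vars a \<Longrightarrow> \<sigma> x = \<tau> x) \<Longrightarrow> subst_atom \<sigma> a = subst_atom \<tau> a"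
  by (cases a) (auto simp: atom_vars_def intro!: subst_trm_cong)

lemma subst_atom_eqD:
  "subst_atom \<sigma> a = subst_atom \<tau> a \<Longrightarrow> x \<in> atom_vars a \<Longrightarrow> \<sigma> x = \<tau> x"
  by (cases a) (auto simp: atom_vars_def dest: subst_trm_eqD)

lemma subst_rule_cong:
  assumes "\<And>a x. a \<in> rule_atoms r \<Longrightarrow> x \<in> atom_vars a \<Longrightarrow> \<sigma> x = \<tau> x"
  shows "subst_rule \<sigma> r = subst_rule \<tau> r"
proof -
  have a: "subst_atom \<sigma> a = subst_atom \<tau> a" if "a \<in> rule_atoms r" for a
    using that assms by (intro subst_atom_cong)
  have "subst_lit \<sigma> l = subst_lit \<tau> l" if "l \<in> set (body r)" for l
  proof -
    have "lit_atom l \<in> rule_atoms r" using that by (simp add: rule_atoms_def)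
    from a[OF this] show ?thesis by (cases l) auto
  qed
  moreover have "subst_atom \<sigma> h = subst_atom \<tau> h" if "h \<in> set (head r)" for h
    using that by (intro a) (simp add: rule_atoms_def)
  ultimately show ?thesis by (cases r) simp
qed

lemma head_subst_rule: "set (head (subst_rule \<sigma> r)) = subst_atom \<sigma> ` set (head r)"
  by (cases r) simp

lemma lit_atom_subst: "lit_atom (subst_lit \<sigma> l) = subst_atom \<sigma> (lit_atom l)"
  by (cases l) auto

lemma rule_atoms_subst_rule: "rule_atoms (subst_rule \<sigma> r) = subst_atom \<sigma> ` rule_atoms r"
  by (cases r) (simp add: rule_atoms_def image_Un image_image lit_atom_subst)

lemma pos_body_subst_rule: "pos_body (subst_rule \<sigma> r) = subst_atom \<sigma> ` pos_body r"
proof -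
  have "Pos a = subst_lit \<sigma> l \<longleftrightarrow> (\<exists>b. l = Pos b \<and> a = subst_atom \<sigma> b)" for a l by (cases l) auto
  then show ?thesis by (cases r) (auto simp: pos_body_def image_iff)
qed

lemma neg_body_subst_rule: "neg_body (subst_rule \<sigma> r) = subst_atom \<sigma> ` neg_body r"
proof -
  have "Neg a = subst_lit \<sigma> l \<longleftrightarrow> (\<exists>b. l = Neg b \<and> a = subst_atom \<sigma> b)" for a l by (cases l) auto
  then show ?thesis by (cases r) (auto simp: neg_body_def image_iff)
qed

lemma subst_trm_herbrand:
  assumes "fsyms_trm t \<subseteq> lang_fsyms P" "\<And>x. \<sigma> x \<in> herbrand_universe P"
  shows "subst_trm \<sigma> t \<in> herbrand_universe P"
  using assms(1)
proof (induction t)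
  case (Fn f ts)
  then have "subst_trm \<sigma> t \<in> herbrand_universe P" if "t \<in> set ts" for t
    using that by auto
  with Fn.prems show ?case by (auto intro!: herbrand_universe.intros)
qed (simp add: assms(2))

lemma subst_atom_herbrand:
  assumes "r \<in> set P" "a \<in> rule_atoms r" "\<And>x. \<sigma> x \<in> herbrand_universe P"
  shows "subst_atom \<sigma> a \<in> herbrand_base P"
proof -
  obtain p ts where a: "a = Atom p ts" by (cases a)
  have "fsyms_trm t \<subseteq> fsyms_prog P" if "t \<in> set ts" for t
    using that assms(1,2) unfolding fsyms_prog_def a by fastforce
  moreover have "fsyms_prog P \<subseteq> lang_fsyms P" unfolding lang_fsyms_def by auto
  ultimately have "\<forall>t\<in>set ts. subst_trm \<sigma> t \<in> herbrand_universe P"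
    using assms(3) by (blast intro: subst_trm_herbrand)
  moreover have "pred_of a \<in> preds_prog P" unfolding preds_prog_def using assms(1,2) by blast
  ultimately show ?thesis unfolding herbrand_base_def a by auto
qed

lemma ground_rule_atoms_herbrand:
  "g \<in> Ground P \<Longrightarrow> rule_atoms g \<subseteq> herbrand_base P"
  unfolding Ground_def using subst_atom_herbrand by (auto simp: rule_atoms_subst_rule)

section \<open>Stable models as stable sets of coded rules\<close>

definition ground_codes :: "program \<Rightarrow> grule set" where
  "ground_codes P = (\<lambda>g. (enc_atom ` set (head g), enc_atom ` pos_body g, enc_atom ` neg_body g))
      ` Ground P"

lemma rule_atoms_eq: "rule_atoms g = set (head g) \<union> pos_body g \<union> neg_body g"
proof -
  have "lit_atom ` set (body g) = pos_body g \<union> neg_body g"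
    unfolding pos_body_def neg_body_def
  proof (safe)
    fix l assume "l \<in> set (body g)" "Neg (lit_atom l) \<notin> set (body g)"
    then show "Pos (lit_atom l) \<in> set (body g)" by - (cases l, auto)
  next
    fix a assume "Pos a \<in> set (body g)"
    then show "a \<in> lit_atom ` set (body g)" by (rule rev_image_eqI) simp
  next
    fix a assume "Neg a \<in> set (body g)"
    then show "a \<in> lit_atom ` set (body g)" by (rule rev_image_eqI) simp
  qed
  then show ?thesis unfolding rule_atoms_def by blast
qed

lemma red_model_ground_codes:
  "red_model (ground_codes P) (enc_atom ` M) (enc_atom ` N) \<longleftrightarrow> is_model (reduct P M) N"
proof -
  have "enc_atom ` A \<inter> enc_atom ` B = {} \<longleftrightarrow> A \<inter> B = {}"
    "enc_atom ` A \<subseteq> enc_atom ` B \<longleftrightarrow> A \<subseteq> B" for A B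
    by (simp_all add: inj_image_subset_iff[OF inj_enc_atom] flip: image_Int[OF inj_enc_atom])
  moreover have "is_model (reduct P M) N \<longleftrightarrow>
    (\<forall>g\<in>Ground P. neg_body g \<inter> M = {} \<longrightarrow> pos_body g \<subseteq> N \<longrightarrow> set (head g) \<inter> N \<noteq> {})"
    by (simp add: is_model_def reduct_def) blast
  ultimately show ?thesis
    unfolding red_model_def ground_codes_def by simp
qed

text \<open>Competitors of the coded set are subsets of it, hence themselves images of sets of
  atoms, so minimality transfers.\<close>

lemma stable_model_iff_stable_set:
  assumes "M \<subseteq> herbrand_base P"
  shows "stable_model P M \<longleftrightarrow> stable_set (ground_codes P) (enc_atom ` M)"
proof -
  have "(\<exists>N. N \<subset> enc_atom ` M \<and> red_model (ground_codes P) (enc_atom ` M) N) \<longleftrightarrow>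
    (\<exists>N. N \<subset> M \<and> red_model (ground_codes P) (enc_atom ` M) (enc_atom ` N))" (is "?l \<longleftrightarrow> ?r")
  proof
    assume ?l
    then obtain N where N: "N \<subset> enc_atom ` M" "red_model (ground_codes P) (enc_atom ` M) N" by blast
    then obtain N' where "N' \<subseteq> M" "N = enc_atom ` N'" by (meson psubset_imp_subset subset_imageE)
    with N show ?r by blast
  next
    assume ?r
    then obtain N where N: "N \<subset> M" "red_model (ground_codes P) (enc_atom ` M) (enc_atom ` N)" by
        blast
    then have "enc_atom ` N \<subset> enc_atom ` M"
      using inj_image_eq_iff[OF inj_enc_atom, of N M] by blast
    with N(2) show ?l by blast
  qed
  then show ?thesis
    unfolding stable_model_def minimal_herbrand_model_def stable_set_def red_model_ground_codes
    using assms by simp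
qed

text \<open>A stable set of numbers could a priori contain numbers that code no atom. Only codes of
  head atoms can occur in it, and these come from the Herbrand base.\<close>

lemma inconsistent_iff_no_stable_set: "inconsistent P \<longleftrightarrow> \<not> (\<exists>M. stable_set (ground_codes P) M)"
proof -
  have "(\<exists>M. stable_model P M) \<longleftrightarrow> (\<exists>M. stable_set (ground_codes P) M)"
  proof
    assume "\<exists>M. stable_model P M"
    then obtain M where M: "stable_model P M" by blast
    then have "M \<subseteq> herbrand_base P" by (simp add: stable_model_def minimal_herbrand_model_def)
    with M show "\<exists>M. stable_set (ground_codes P) M" using stable_model_iff_stable_set by blast
  next
    assume "\<exists>M. stable_set (ground_codes P) M"
    then obtain M where M: "stable_set (ground_codes P) M" by blast
    have "\<Union> (fst ` ground_codes P) \<subseteq> enc_atom ` herbrand_base P"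
      unfolding ground_codes_def
    proof clarsimp
      fix g a assume "g \<in> Ground P" "a \<in> set (head g)"
      with ground_rule_atoms_herbrand[of g P] show "enc_atom a \<in> enc_atom ` herbrand_base P"
        unfolding rule_atoms_eq by blast
    qed
    with stable_set_subset_heads[OF M] have "M \<subseteq> enc_atom ` herbrand_base P" by blast
    then obtain N where "N \<subseteq> herbrand_base P" "M = enc_atom ` N" by (rule subset_imageE)
    with M show "\<exists>M. stable_model P M" using stable_model_iff_stable_set by blast
  qed
  then show ?thesis unfolding inconsistent_def by simp
qed

lemma finite_splitting_set:
  assumes fr: "finitely_recursive P"
  shows "\<exists>U. finite U \<and> splitting (ground_codes P) U \<and> x \<in> U"
proof (cases "x \<in> enc_atom ` herbrand_base P")
  case True
  then obtain a where a: "a \<in> herbrand_base P" "x = enc_atom a" by blast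
  let ?D = "{b. depends P a b}"
  have "finite ?D" using fr a(1) unfolding finitely_recursive_def by blast
  moreover have "splitting (ground_codes P) (enc_atom ` ?D)"
    unfolding splitting_def
  proof safe
    fix H B C z assume "(H, B, C) \<in> meeting (ground_codes P) (enc_atom ` ?D)"
    then obtain g where g: "g \<in> Ground P" "H = enc_atom ` set (head g)" "B = enc_atom ` pos_body g"
      "C = enc_atom ` neg_body g" "enc_atom ` set (head g) \<inter> enc_atom ` ?D \<noteq> {}"
      unfolding meeting_def ground_codes_def by auto
    from g(5) obtain h where h: "h \<in> set (head g)" "depends P a h"
      by (auto simp: enc_atom_inject)
    have "depends P a b" if "b \<in> rule_atoms g" for b
    proof -
      have "(h, b) \<in> dep_edges P" unfolding dep_edges_def using g(1) h(1) that by blast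
      with h(2) show ?thesis unfolding depends_def by (rule rtrancl_into_rtrancl)
    qed
    then have all: "enc_atom ` rule_atoms g \<subseteq> enc_atom ` ?D" by blast
    { assume "z \<in> H" with g all show "z \<in> enc_atom ` ?D" unfolding rule_atoms_eq by blast }
    { assume "z \<in> B" with g all show "z \<in> enc_atom ` ?D" unfolding rule_atoms_eq by blast }
    { assume "z \<in> C" with g all show "z \<in> enc_atom ` ?D" unfolding rule_atoms_eq by blast }
  qed
  moreover have "x \<in> enc_atom ` ?D" using a(2) by (auto simp: depends_def)
  ultimately show ?thesis by (intro exI[of _ "enc_atom ` ?D"]) simp
next
  case False
  \<comment> \<open>Compactness enumerates all natural numbers. One that codes no Herbrand atom
    occurs in no head, so its singleton is vacuously splitting.\<close>
  have "fst c \<inter> {x} = {}" if c: "c \<in> ground_codes P" for c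
  proof -
    from c obtain g where "g \<in> Ground P" "fst c = enc_atom ` set (head g)"
      unfolding ground_codes_def by auto
    with ground_rule_atoms_herbrand[of g P] False show ?thesis unfolding rule_atoms_eq by blast
  qed
  then have "meeting (ground_codes P) {x} = {}" unfolding meeting_def by blast
  then have "splitting (ground_codes P) {x}" unfolding splitting_def by simp
  then show ?thesis by (intro exI[of _ "{x}"]) simp
qed


section \<open>Bounding the relevant ground substitutions\<close>

lemma subterms_subst: "Var x \<in> subterms t \<Longrightarrow> \<sigma> x \<in> subterms (subst_trm \<sigma> t)"
  by (induction t) (auto simp: subterms_refl)

lemma enc_subst_le_enc_atom:
  assumes "x \<in> atom_vars a" shows "enc_trm (\<sigma> x) \<le> enc_atom (subst_atom \<sigma> a)"
proof -
  obtain p ts where a: "a = Atom p ts" by (cases a)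
  obtain t where t: "t \<in> set ts" "Var x \<in> subterms t" using assms by (auto simp: a atom_vars_def)
  have "enc_trm (\<sigma> x) \<le> enc_trm (subst_trm \<sigma> t)"
    using subterms_subst[OF t(2)] by (intro subterm_code_le) (simp add: subterm_code_enc_trm)
  also have "\<dots> < list_encode (map enc_trm (map (subst_trm \<sigma>) ts))"
    using t(1) by (intro mem_less_list_encode) simp
  also have "\<dots> \<le> enc_atom (subst_atom \<sigma> a)" by (simp add: a le_prod_encode_2)
  finally show ?thesis by simp
qed

lemma small_constant: "(c, 0) \<in> lang_fsyms P \<Longrightarrow> enc_trm (Fn c []) \<le> enc_prog P + 2"
proof (cases "(c, 0) \<in> fsyms_prog P")
  case True
  then have "prog_subterm_code (enc_prog P) (enc_trm (Fn c []))" unfolding fsyms_prog_iff by auto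
  then show ?thesis by (rule trans_le_add1[OF prog_subterm_code_le])
next
  case False
  assume "(c, 0) \<in> lang_fsyms P"
  with False have "c = 0" unfolding lang_fsyms_def by (auto split: if_splits)
  then show ?thesis by (simp add: prod_encode_def)
qed

lemma ex_constant: "\<exists>c. (c, 0) \<in> lang_fsyms P"
  unfolding lang_fsyms_def by auto

lemma constant_herbrand: "(c, 0) \<in> lang_fsyms P \<Longrightarrow> Fn c [] \<in> herbrand_universe P"
  by (rule herbrand_universe.intros) auto

text \<open>Applying a symbol of positive arity to a term of largest code would give a term of still
  larger code.\<close>

lemma finite_herbrand_constant:
  assumes fin: "finite (herbrand_universe P)" and u: "u \<in> herbrand_universe P"
  shows "\<exists>c. u = Fn c [] \<and> (c, 0) \<in> lang_fsyms P"
proof -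
  obtain f ts where f: "u = Fn f ts" "(f, length ts) \<in> lang_fsyms P"
    using subterms_herbrand[OF u subterms_refl] by blast
  have "ts = []"
  proof (rule ccontr)
    assume "ts \<noteq> []"
    define m where "m = Max (enc_trm ` herbrand_universe P)"
    have "m \<in> enc_trm ` herbrand_universe P"
      unfolding m_def using fin u by (intro Max_in) auto
    then obtain t where t: "t \<in> herbrand_universe P" "m = enc_trm t" by blast
    let ?t' = "Fn f (replicate (length ts) t)"
    have "?t' \<in> herbrand_universe P" using f(2) t(1) by (intro herbrand_universe.intros) auto
    then have "enc_trm ?t' \<le> m" unfolding m_def using fin by (intro Max_ge finite_imageI imageI)
    moreover have "enc_trm t < enc_trm ?t'"
      by (rule arg_less) (use \<open>ts \<noteq> []\<close> in auto)
    ultimately show False using t(2) by simp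
  qed
  with f show ?thesis by auto
qed

text \<open>In an infinite Herbrand universe, a variable of a rule that does not occur in its head atom
  \<open>h\<close> would make an instance of \<open>h\<close> depend on infinitely many atoms. In a finite one
  all terms are constants of the program.\<close>

lemma ground_instance_bounded:
  assumes fr: "finitely_recursive P" and r: "r \<in> set P" and h: "h \<in> set (head r)"
    and \<sigma>: "\<And>x. \<sigma> x \<in> herbrand_universe P" and u: "enc_atom (subst_atom \<sigma> h) \<le> u"
  shows "\<exists>\<tau>. (\<forall>x. \<tau> x \<in> herbrand_universe P \<and> enc_trm (\<tau> x) \<le> u + enc_prog P + 2) \<and>
    subst_rule \<tau> r = subst_rule \<sigma> r"
proof (cases "finite (herbrand_universe P)")
  case True
  have "enc_trm (\<sigma> x) \<le> u + enc_prog P + 2" for x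
  proof -
    obtain c where "\<sigma> x = Fn c []" "(c, 0) \<in> lang_fsyms P"
      using finite_herbrand_constant[OF True \<sigma>] by blast
    with small_constant[of c P] show ?thesis by simp
  qed
  with \<sigma> show ?thesis by (intro exI[of _ \<sigma>]) simp
next
  case False
  have vars: "x \<in> atom_vars h" if a: "a \<in> rule_atoms r" "x \<in> atom_vars a" for a x
  proof (rule ccontr)
    assume x: "x \<notin> atom_vars h"
    have hr: "h \<in> rule_atoms r" using h by (simp add: rule_atoms_def)
    let ?i = "\<lambda>t. subst_atom (\<sigma>(x := t)) a"
    \<comment> \<open>Changing the value of \<open>x\<close> leaves the head instance fixed, so all
      these instances of \<open>a\<close> are direct successors of one atom.\<close>
    have "depends P (subst_atom \<sigma> h) (?i t)" if t: "t \<in> herbrand_universe P" for t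
    proof -
      let ?r = "subst_rule (\<sigma>(x := t)) r"
      have "?r \<in> Ground P" unfolding Ground_def mem_Collect_eq using r \<sigma> t
        by (intro exI[of _ "\<sigma>(x := t)"] exI[of _ r]) simp
      moreover have "subst_atom \<sigma> h = subst_atom (\<sigma>(x := t)) h"
        using x by (intro subst_atom_cong) auto
      then have "subst_atom \<sigma> h \<in> set (head ?r)" unfolding head_subst_rule using h by simp
      moreover have "?i t \<in> rule_atoms ?r" unfolding rule_atoms_subst_rule using a(1) by simp
      ultimately show ?thesis unfolding depends_def dep_edges_def by blast
    qed
    then have "?i ` herbrand_universe P \<subseteq> {b. depends P (subst_atom \<sigma> h) b}" by blast
    moreover have "subst_atom \<sigma> h \<in> herbrand_base P"
      by (rule subst_atom_herbrand[OF r hr]) (rule \<sigma>)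
    then have "finite {b. depends P (subst_atom \<sigma> h) b}"
      using fr unfolding finitely_recursive_def by blast
    ultimately have "finite (?i ` herbrand_universe P)" by (rule finite_subset)
    moreover have "inj_on ?i (herbrand_universe P)"
    proof (rule inj_onI)
      fix t t' assume "?i t = ?i t'"
      then have "(\<sigma>(x := t)) x = (\<sigma>(x := t')) x" using a(2) by (rule subst_atom_eqD)
      then show "t = t'" by simp
    qed
    ultimately show False using False finite_imageD by blast
  qed
  obtain c where c: "(c, 0) \<in> lang_fsyms P" using ex_constant by blast
  \<comment> \<open>Values at variables of \<open>h\<close> occur inside the head instance and so
    have codes at most \<open>u\<close>. By \<open>vars\<close> the remaining variables do not occur
    in the rule; they get a constant only to make the bound hold at every index.\<close>
  let ?\<tau> = "\<lambda>x. if x \<in> atom_vars h then \<sigma> x else Fn c []"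
  have "?\<tau> x \<in> herbrand_universe P" for x using \<sigma> constant_herbrand[OF c] by simp
  moreover have "enc_trm (?\<tau> x) \<le> u + enc_prog P + 2" for x
  proof (cases "x \<in> atom_vars h")
    case True
    with enc_subst_le_enc_atom[OF True, of \<sigma>] u show ?thesis by simp
  next
    case False
    with small_constant[OF c] show ?thesis by simp
  qed
  moreover have "subst_rule ?\<tau> r = subst_rule \<sigma> r"
    using vars by (intro subst_rule_cong) auto
  ultimately show ?thesis by (intro exI[of _ ?\<tau>] conjI allI)
qed

lemma subst_trm_code_enc_trm:
  "(\<And>x. Var x \<in> subterms t \<Longrightarrow> lnth s x = enc_trm (\<sigma> x)) \<Longrightarrow> subst_trm_code s (enc_trm t) = enc_trm
      (subst_trm \<sigma> t)"
proof (induction t)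
  case (Var x)
  then show ?case by (simp add: subst_trm_code.simps)
next
  case (Fn f ts)
  have "map (subst_trm_code s) (map enc_trm ts) = map enc_trm (map (subst_trm \<sigma>) ts)"
    using Fn by auto
  then show ?case by (simp add: subst_trm_code.simps[of s "prod_encode _"] del: map_map)
qed

lemma subst_atom_code_enc_atom:
  assumes "\<And>x. x \<in> atom_vars a \<Longrightarrow> lnth s x = enc_trm (\<sigma> x)"
  shows "subst_atom_code s (enc_atom a) = enc_atom (subst_atom \<sigma> a)"
proof -
  obtain p ts where a: "a = Atom p ts" by (cases a)
  have "map (subst_trm_code s) (map enc_trm ts) = map enc_trm (map (subst_trm \<sigma>) ts)"
    using assms unfolding a atom_vars_def by (auto intro!: subst_trm_code_enc_trm)
  then show ?thesis by (simp add: a subst_atom_code_def del: map_map)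
qed

lemma code_rule_enc_rule:
  assumes "\<And>a x. a \<in> rule_atoms r \<Longrightarrow> x \<in> atom_vars a \<Longrightarrow> lnth s x = enc_trm (\<sigma> x)"
  shows "code_rule s (enc_rule r) = (\<lambda>g. (enc_atom ` set (head g), enc_atom ` pos_body g,
    enc_atom ` neg_body g)) (subst_rule \<sigma> r)"
proof -
  have subst_atom_code: "subst_atom_code s (enc_atom a) = enc_atom (subst_atom \<sigma> a)" if "a \<in>
      rule_atoms r" for a
    using assms[OF that] by (rule subst_atom_code_enc_atom)
  have img: "subst_atom_code s ` enc_atom ` A = enc_atom ` subst_atom \<sigma> ` A" if "A \<subseteq> rule_atoms r"
      for A
    unfolding image_image using subst_atom_code that by (intro image_cong) auto
  have sub: "set (head r) \<subseteq> rule_atoms r" "pos_body r \<subseteq> rule_atoms r" "neg_body r \<subseteq> rule_atoms r"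
    unfolding rule_atoms_eq by blast+
  have "{subst_atom_code s (psnd l) | l. l \<in> enc_lit ` set (body r) \<and> pfst l = 0} =
      subst_atom_code s ` enc_atom ` pos_body r"
  proof -
    have "pfst (enc_lit l) = 0 \<longleftrightarrow> (\<exists>a. l = Pos a)" for l by (cases l) auto
    then show ?thesis by (force simp: pos_body_def image_iff)
  qed
  moreover have "{subst_atom_code s (psnd l) | l. l \<in> enc_lit ` set (body r) \<and> pfst l = 1} =
      subst_atom_code s ` enc_atom ` neg_body r"
  proof -
    have "pfst (enc_lit l) = 1 \<longleftrightarrow> (\<exists>a. l = Neg a)" for l by (cases l) auto
    then show ?thesis by (force simp: neg_body_def image_iff)
  qed
  ultimately show ?thesis
    unfolding code_rule_def enc_rule_simps head_subst_rule pos_body_subst_rule neg_body_subst_rule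
    by (simp add: img sub)
qed

text \<open>A variable is a subterm of the program, and its index is at most its code. This is the
  origin of the length \<open>Suc e\<close> of substitution lists.\<close>

lemma var_le_enc_prog:
  assumes "r \<in> set P" "a \<in> rule_atoms r" "x \<in> atom_vars a"
  shows "x \<le> enc_prog P"
proof -
  have "prog_subterm_code (enc_prog P) (enc_trm (Var x))"
    using assms unfolding prog_subterm_code_enc_prog atom_vars_def by blast
  then have "enc_trm (Var x) \<le> enc_prog P" by (rule prog_subterm_code_le)
  with le_prod_encode_2[of x 0] show ?thesis by simp
qed

lemma code_rules_subset: "code_rules (enc_prog P) n \<subseteq> ground_codes P"
proof
  fix c assume "c \<in> code_rules (enc_prog P) n"
  then obtain s r where s: "valid_subst (enc_prog P) n s" and r: "r \<in> set P" "c = code_rule s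
      (enc_rule r)"
    unfolding code_rules_def list_decode_enc_prog by auto
  define xs where "xs = list_decode s"
  obtain k where k: "(k, 0) \<in> lang_fsyms P" using ex_constant by blast
  \<comment> \<open>The list \<open>s\<close> has entries only up to index
    \<open>enc_prog P\<close>. Larger variables do not occur in \<open>P\<close> and may take any
    Herbrand term.\<close>
  have "\<exists>u\<in>herbrand_universe P. x \<le> enc_prog P \<longrightarrow> lnth s x = enc_trm u" for x
  proof (cases "x \<le> enc_prog P")
    case True
    then have x: "x < length xs" using s unfolding valid_subst_def xs_def by simp
    then have "lnth s x = xs ! x" using lnth_list_encode[OF x] by (simp add: xs_def)
    moreover have "ground_code (enc_prog P) (xs ! x)"
      using s nth_mem[OF x] unfolding valid_subst_def xs_def by blast
    ultimately show ?thesis unfolding ground_code_enc_prog by auto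
  next
    case False
    with constant_herbrand[OF k] show ?thesis by blast
  qed
  then obtain \<sigma> where \<sigma>: "\<And>x. \<sigma> x \<in> herbrand_universe P"
    "\<And>x. x \<le> enc_prog P \<Longrightarrow> lnth s x = enc_trm (\<sigma> x)" by metis
  have "subst_rule \<sigma> r \<in> Ground P" unfolding Ground_def using r(1) \<sigma>(1) by blast
  moreover have "c = (\<lambda>g. (enc_atom ` set (head g), enc_atom ` pos_body g,
    enc_atom ` neg_body g)) (subst_rule \<sigma> r)"
    unfolding r(2) by (rule code_rule_enc_rule) (rule \<sigma>(2)[OF var_le_enc_prog[OF r(1)]])
  ultimately show "c \<in> ground_codes P" unfolding ground_codes_def by blast
qed

text \<open>The bridge between the test and the program. A head atom in \<open>set_decode u\<close>
  has code below \<open>u\<close>, so \<open>ground_instance_bounded\<close> replaces its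
  substitution by a bounded one with the same rule instance.\<close>

lemma meeting_code_rules:
  assumes "finitely_recursive P"
  shows "meeting (code_rules (enc_prog P) (u + enc_prog P + 2)) (set_decode u) =
    meeting (ground_codes P) (set_decode u)" (is "meeting ?C ?U = _")
proof
  show "meeting ?C ?U \<subseteq> meeting (ground_codes P) ?U"
    using code_rules_subset unfolding meeting_def by blast
  show "meeting (ground_codes P) ?U \<subseteq> meeting ?C ?U"
  proof
    fix c assume c: "c \<in> meeting (ground_codes P) ?U"
    then obtain \<sigma> r where r: "r \<in> set P" "\<And>x. \<sigma> x \<in> herbrand_universe P"
      "c = (\<lambda>g. (enc_atom ` set (head g), enc_atom ` pos_body g,
         enc_atom ` neg_body g)) (subst_rule \<sigma> r)"
      "fst c \<inter> ?U \<noteq> {}"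
      unfolding meeting_def ground_codes_def Ground_def by blast
    from r(3,4) obtain h where h: "h \<in> set (head r)" "enc_atom (subst_atom \<sigma> h) \<in> ?U"
      by (auto simp: head_subst_rule)
    have "enc_atom (subst_atom \<sigma> h) \<le> u" using mem_set_decode_less[OF h(2)] by simp
    from ground_instance_bounded[OF assms r(1) h(1) r(2) this] obtain \<tau> where
      \<tau>: "\<And>x. \<tau> x \<in> herbrand_universe P" "\<And>x. enc_trm (\<tau> x) \<le> u + enc_prog P + 2"
        "subst_rule \<tau> r = subst_rule \<sigma> r" by blast
    \<comment> \<open>The list tabulates \<open>\<tau>\<close> at the indices from 0 up to and
      including \<open>enc_prog P\<close>.\<close>
    define s where "s = list_encode (map (\<lambda>x. enc_trm (\<tau> x)) [0..<Suc (enc_prog P)])"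
    have "valid_subst (enc_prog P) (u + enc_prog P + 2) s"
      unfolding valid_subst_def ground_code_enc_prog s_def using \<tau>(1,2)
      by (auto simp del: upt_Suc)
    moreover have "code_rule s (enc_rule r) = c"
      unfolding r(3) \<tau>(3)[symmetric]
    proof (rule code_rule_enc_rule)
      fix a x assume "a \<in> rule_atoms r" "x \<in> atom_vars a"
      then have "x < Suc (enc_prog P)" using var_le_enc_prog[OF r(1)] by (simp add: less_Suc_eq_le)
      then show "lnth s x = enc_trm (\<tau> x)"
        unfolding s_def by (subst lnth_list_encode) (simp_all del: upt_Suc)
    qed
    ultimately have "c \<in> ?C" using r(1) unfolding code_rules_def list_decode_enc_prog by auto
    with r(4) show "c \<in> meeting ?C ?U" unfolding meeting_def by simp
  qed
qed

lemma refutes_enc_prog: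
  assumes "finitely_recursive P"
  shows "refutes (enc_prog P) u \<longleftrightarrow> splitting (ground_codes P) (set_decode u) \<and>
    (\<forall>M\<subseteq>set_decode u. \<not> stable_set (meeting (ground_codes P) (set_decode u)) M)"
proof -
  have "refutes (enc_prog P) u \<longleftrightarrow> splitting (code_rules (enc_prog P) (u + enc_prog P + 2))
      (set_decode u) \<and>
    (\<forall>M\<subseteq>set_decode u. \<not> stable_set (meeting (code_rules (enc_prog P) (u + enc_prog P + 2))
        (set_decode u)) M)"
  proof (rule refutes_iff)
    fix r l assume "r \<in> set (list_decode (enc_prog P))" "l \<in> set (list_decode (psnd r))"
    then obtain l' where "l = enc_lit l'" by (auto simp: list_decode_enc_prog enc_rule_simps)
    then show "pfst l = 0 \<or> pfst l = 1" by (cases l') auto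
  qed
  then show ?thesis unfolding splitting_def meeting_code_rules[OF assms] .
qed

theorem theorem5p1:
  shows "\<exists>f :: recf. \<forall>P :: program. wf_program P \<and> finitely_recursive P \<longrightarrow>
           (halts f (enc_prog P) \<longleftrightarrow> inconsistent P)"
proof -
  obtain f where f: "\<And>e. halts f e \<longleftrightarrow> (\<exists>u. refutes e u)" using refutes_search by blast
  have "halts f (enc_prog P) \<longleftrightarrow> inconsistent P" if P: "wf_program P" "finitely_recursive P" for P
  proof -
    have "(\<exists>U. finite U \<and> splitting (ground_codes P) U \<and> (\<forall>M\<subseteq>U. \<not> stable_set (meeting
        (ground_codes P) U) M))
      \<longleftrightarrow> (\<exists>u. refutes (enc_prog P) u)"
      unfolding refutes_enc_prog[OF P(2)] using set_decode_ex finite_set_decode by metis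
    moreover have "inconsistent P \<longleftrightarrow>
      (\<exists>U. finite U \<and> splitting (ground_codes P) U \<and> (\<forall>M\<subseteq>U. \<not> stable_set (meeting (ground_codes P)
          U) M))"
      unfolding inconsistent_iff_no_stable_set
    proof (rule no_stable_set_iff_finite)
      fix H B C assume "(H, B, C) \<in> ground_codes P"
      \<comment> \<open>Well-formedness passes to ground instances and supplies the nonempty heads
        required for compactness.\<close>
      moreover have "head (subst_rule \<sigma> r) = [] \<longleftrightarrow> head r = []" for \<sigma> r by (cases r) simp
      ultimately show "H \<noteq> {}" using P(1)
        unfolding ground_codes_def Ground_def wf_program_def by auto
    qed (rule finite_splitting_set[OF P(2)])
    ultimately show ?thesis using f by simp
  qed
  then show ?thesis by blast
qed

end
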